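(* Let $H$ be a finite group of size $m$ and let $n$ be a positive integer that is a multiple of $m$. Then there exists a first-order formula $\varepsilon_{H,n}(x_1,\ldots,x_n)$ in the language of rings without parameters, depending on $H$ and $n$ only, such that for every field $F$: $F\models \exists x_1\cdots\exists x_n\, \varepsilon_{H,n}(x_1,\ldots,x_n)$ if and only if there exists a field extension $L/F$ of degree $n$ such that $\mathrm{Aut}(L/F)\cong H$.
   Context: The language of rings is $(0,1,+,\times)$. $\mathrm{Aut}(L/F)$ denotes the group of field automorphisms of $L$ fixing $F$ pointwise. The extension $L/F$ is not required to be Galois. *)

theory Defs
  imports "HOL-Algebra.Algebra"
begin

section \<open>First-order formulas in the language of rings\<close>

datatype rterm = RVar nat | RZero | ROne | RAdd rterm rterm | RMult rterm rterm

datatype rform = REq rterm rterm | RNeg rform | RConj rform rform | REx nat rform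

primrec rterm_vars :: "rterm \<Rightarrow> nat set" where
  "rterm_vars (RVar i) = {i}"
| "rterm_vars RZero = {}"
| "rterm_vars ROne = {}"
| "rterm_vars (RAdd s t) = rterm_vars s \<union> rterm_vars t"
| "rterm_vars (RMult s t) = rterm_vars s \<union> rterm_vars t"

primrec free_vars :: "rform \<Rightarrow> nat set" where
  "free_vars (REq s t) = rterm_vars s \<union> rterm_vars t"
| "free_vars (RNeg p) = free_vars p"
| "free_vars (RConj p q) = free_vars p \<union> free_vars q"
| "free_vars (REx i p) = free_vars p - {i}"

primrec rterm_val :: "('a, 'c) ring_scheme \<Rightarrow> (nat \<Rightarrow> 'a) \<Rightarrow> rterm \<Rightarrow> 'a" where
  "rterm_val R e (RVar i) = e i"
| "rterm_val R e RZero = \<zero>\<^bsub>R\<^esub>"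
| "rterm_val R e ROne = \<one>\<^bsub>R\<^esub>"
| "rterm_val R e (RAdd s t) = rterm_val R e s \<oplus>\<^bsub>R\<^esub> rterm_val R e t"
| "rterm_val R e (RMult s t) = rterm_val R e s \<otimes>\<^bsub>R\<^esub> rterm_val R e t"

primrec holds :: "('a, 'c) ring_scheme \<Rightarrow> (nat \<Rightarrow> 'a) \<Rightarrow> rform \<Rightarrow> bool" where
  "holds R e (REq s t) \<longleftrightarrow> rterm_val R e s = rterm_val R e t"
| "holds R e (RNeg p) \<longleftrightarrow> \<not> holds R e p"
| "holds R e (RConj p q) \<longleftrightarrow> holds R e p \<and> holds R e q"
| "holds R e (REx i p) \<longleftrightarrow> (\<exists>a \<in> carrier R. holds R (e(i := a)) p)"

text \<open>Truth in \<open>R\<close>; for a sentence the assignment \<open>e\<close> is irrelevant, as \<open>carrier R\<close> is non-empty.\<close>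

definition models :: "('a, 'c) ring_scheme \<Rightarrow> rform \<Rightarrow> bool" (infix \<open>\<Turnstile>\<^sub>R\<close> 50) where
  "R \<Turnstile>\<^sub>R p \<longleftrightarrow> (\<forall>e. range e \<subseteq> carrier R \<longrightarrow> holds R e p)"

text \<open>The variables \<open>x\<^sub>1, \<dots>, x\<^sub>n\<close> are \<open>RVar 1, \<dots>, RVar n\<close>.\<close>

definition REx_upto :: "nat \<Rightarrow> rform \<Rightarrow> rform" where
  "REx_upto n p = foldr REx [1..<Suc n] p"


section \<open>Field extensions with prescribed degree and automorphism group\<close>

text \<open>An extension of \<open>F\<close> is a field \<open>L\<close> together with a homomorphism \<open>h\<close> from \<open>F\<close> to \<open>L\<close>
  (automatically injective); \<open>F\<close> is identified with \<open>h ` carrier F\<close>.\<close>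

definition field_ext :: "'a ring \<Rightarrow> 'b ring \<Rightarrow> ('a \<Rightarrow> 'b) \<Rightarrow> bool" where
  "field_ext F L h \<longleftrightarrow> field F \<and> field L \<and> h \<in> ring_hom F L"

definition ext_degree :: "'a ring \<Rightarrow> 'b ring \<Rightarrow> ('a \<Rightarrow> 'b) \<Rightarrow> nat \<Rightarrow> bool" where
  "ext_degree F L h n \<longleftrightarrow> ring.dimension L n (h ` carrier F) (carrier L)"

definition Aut_ext :: "'a ring \<Rightarrow> 'b ring \<Rightarrow> ('a \<Rightarrow> 'b) \<Rightarrow> ('b \<Rightarrow> 'b) monoid" where
  "Aut_ext F L h = (BijGroup (carrier L))
     \<lparr>carrier := {s \<in> Bij (carrier L). s \<in> ring_hom L L \<and> (\<forall>x \<in> h ` carrier F. s x = x)}\<rparr>"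

definition is_ext_with_Aut :: "'a ring \<Rightarrow> 'b ring \<Rightarrow> ('a \<Rightarrow> 'b) \<Rightarrow> nat \<Rightarrow> 'h monoid \<Rightarrow> bool" where
  "is_ext_with_Aut F L h n H \<longleftrightarrow> field_ext F L h \<and> ext_degree F L h n \<and> Aut_ext F L h \<cong> H"

text \<open>HOL cannot quantify existentially over the type of \<open>L\<close>. The type of coordinate lists over
  \<open>F\<close> is large enough for every extension of finite degree; see \<open>has_ext_with_AutI\<close> below.\<close>

definition has_ext_with_Aut :: "'a ring \<Rightarrow> nat \<Rightarrow> 'h monoid \<Rightarrow> bool" where
  "has_ext_with_Aut F n H \<longleftrightarrow> (\<exists>(L :: 'a list ring) h. is_ext_with_Aut F L h n H)"

lemma ext_degree_inj_on_lists:
  fixes F :: "'a ring" and L :: "'b ring"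
  assumes "field_ext F L h" and "ext_degree F L h n"
  shows "\<exists>j :: 'b \<Rightarrow> 'a list. inj_on j (carrier L)"
proof -
  interpret F: field F using assms by (simp add: field_ext_def)
  interpret L: field L using assms by (simp add: field_ext_def)
  interpret h: ring_hom_ring F L h
    using assms by (intro ring_hom_ringI2) (auto simp: field_ext_def F.ring_axioms L.ring_axioms)
  let ?K = "h ` carrier F"
  have K: "subfield ?K L"
    using h.img_is_subfield(2)[OF F.carrier_is_subfield] L.one_not_zero by simp
  obtain Us where Us: "set Us \<subseteq> carrier L" "L.Span ?K Us = carrier L"
    using L.exists_base[OF K] assms(2) unfolding ext_degree_def by metis
  have ex: "\<exists>ks. x = L.combine (map h ks) Us" if "x \<in> carrier L" for x
  proof -
    have "x \<in> {L.combine Ks Us | Ks. set Ks \<subseteq> ?K}"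
      using that by (simp only: L.Span_eq_combine_set[OF K Us(1), symmetric] Us(2))
    then obtain Ks where "set Ks \<subseteq> ?K" "x = L.combine Ks Us" by blast
    moreover from this(1) have "\<exists>ks. Ks = map h ks"
      using ex_map_conv[of Ks h] by blast
    ultimately show ?thesis by blast
  qed
  define j where "j x = (SOME ks. x = L.combine (map h ks) Us)" for x
  have j: "x = L.combine (map h (j x)) Us" if "x \<in> carrier L" for x
    unfolding j_def by (rule someI_ex[OF ex[OF that]])
  have "inj_on j (carrier L)"
  proof (rule inj_onI)
    fix x y assume x: "x \<in> carrier L" and y: "y \<in> carrier L" and eq: "j x = j y"
    show "x = y" by (subst j[OF x], subst j[OF y]) (simp only: eq)
  qed
  then show ?thesis by blast
qed

lemma Aut_transport:
  fixes L :: "'b ring" and M :: "'c ring"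
  assumes L: "ring L" and M: "ring M" and j: "j \<in> ring_iso L M" and K: "K \<subseteq> carrier L"
    and s: "s \<in> Bij (carrier L)" "s \<in> ring_hom L L" "\<forall>x \<in> K. s x = x"
  defines "k \<equiv> inv_into (carrier L) j"
  defines "t \<equiv> \<lambda>y \<in> carrier M. j (s (k y))"
  shows "t \<in> Bij (carrier M)" "t \<in> ring_hom M M" "\<forall>y \<in> j ` K. t y = y"
proof -
  have jb: "bij_betw j (carrier L) (carrier M)" and jh: "j \<in> ring_hom L M"
    using j by (auto simp: ring_iso_def)
  have kb: "bij_betw k (carrier M) (carrier L)"
    unfolding k_def by (rule bij_betw_inv_into[OF jb])
  have "k \<in> ring_iso M L" unfolding k_def by (rule ring_iso_set_sym[OF L j])
  then have kh: "k \<in> ring_hom M L" by (simp add: ring_iso_def)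
  have sb: "bij_betw s (carrier L) (carrier L)" using s(1) by (simp add: Bij_def)
  have jsk: "bij_betw (j \<circ> (s \<circ> k)) (carrier M) (carrier M)"
    by (rule bij_betw_trans[OF bij_betw_trans[OF kb sb] jb])
  have "bij_betw t (carrier M) (carrier M)"
    using jsk by (simp add: t_def cong: bij_betw_cong)
  then show "t \<in> Bij (carrier M)" by (simp add: Bij_def t_def)
  have "j \<circ> (s \<circ> k) \<in> ring_hom M M"
    using ring_hom_trans[OF ring_hom_trans[OF kh s(2)] jh] .
  then show "t \<in> ring_hom M M"
    using ring.ring_simprules(1,5)[OF M] ring.ring_simprules(6)[OF M]
    by (auto simp: ring_hom_def t_def)
  show "\<forall>y \<in> j ` K. t y = y"
  proof
    fix y assume "y \<in> j ` K"
    then obtain x where x: "x \<in> K" "y = j x" by blast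
    then have "x \<in> carrier L" using K by blast
    moreover from this have "y \<in> carrier M" using jb x(2) by (auto simp: bij_betw_def)
    ultimately show "t y = y"
      using x s(3) jb by (simp add: t_def k_def bij_betw_def inv_into_f_f)
  qed
qed

lemma Aut_ext_image_iso:
  fixes F :: "'a ring" and L :: "'b ring" and M :: "'c ring"
  assumes L: "ring L" and M: "ring M" and j: "j \<in> ring_iso L M"
    and h: "h ` carrier F \<subseteq> carrier L"
  shows "Aut_ext F M (j \<circ> h) \<cong> Aut_ext F L h"
proof -
  define k where "k = inv_into (carrier L) j"
  have jb: "bij_betw j (carrier L) (carrier M)" using j by (auto simp: ring_iso_def)
  have kb: "bij_betw k (carrier M) (carrier L)"
    unfolding k_def by (rule bij_betw_inv_into[OF jb])
  have k: "k \<in> ring_iso M L" unfolding k_def by (rule ring_iso_set_sym[OF L j])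
  have kj: "k (j x) = x" if "x \<in> carrier L" for x
    using that jb by (simp add: k_def bij_betw_def inv_into_f_f)
  have jk: "j (k y) = y" if "y \<in> carrier M" for y
    using that jb by (simp add: k_def bij_betw_def f_inv_into_f)
  have kM: "k y \<in> carrier L" if "y \<in> carrier M" for y
    using that kb by (auto simp: bij_betw_def)
  have jL: "j x \<in> carrier M" if "x \<in> carrier L" for x
    using that jb by (auto simp: bij_betw_def)
  have invk: "inv_into (carrier M) k x = j x" if "x \<in> carrier L" for x
    using that kb kj jL by (metis bij_betw_def inv_into_f_eq)
  define f where "f = (\<lambda>t. \<lambda>x \<in> carrier L. k (t (j x)))"
  define g where "g = (\<lambda>s. \<lambda>y \<in> carrier M. j (s (k y)))"
  let ?A = "carrier (Aut_ext F L h)" and ?B = "carrier (Aut_ext F M (j \<circ> h))"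
  have A: "s \<in> ?A \<longleftrightarrow> s \<in> Bij (carrier L) \<and> s \<in> ring_hom L L \<and> (\<forall>x \<in> h ` carrier F. s x = x)" for s
    by (simp add: Aut_ext_def)
  have B: "t \<in> ?B \<longleftrightarrow> t \<in> Bij (carrier M) \<and> t \<in> ring_hom M M \<and> (\<forall>y \<in> j ` h ` carrier F. t y = y)" for t
    by (simp add: Aut_ext_def image_comp)
  have gB: "g s \<in> ?B" if "s \<in> ?A" for s
    using Aut_transport[OF L M j h, of s] that unfolding A B g_def k_def by blast
  have kjh: "k ` j ` h ` carrier F = h ` carrier F"
    using kj h by (force simp: image_iff)
  have jhM: "j ` h ` carrier F \<subseteq> carrier M" using h jL by blast
  have fA: "f t \<in> ?A" if "t \<in> ?B" for t
  proof -
    have "f t = (\<lambda>x \<in> carrier L. k (t (inv_into (carrier M) k x)))"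
      by (auto simp: f_def invk)
    then show ?thesis
      using Aut_transport[OF M L k jhM, of t] that unfolding A B kjh by simp
  qed
  have tM: "t y \<in> carrier M" if "t \<in> ?B" "y \<in> carrier M" for t y
    using that by (auto simp: B Bij_def bij_betw_def)
  have sL: "s x \<in> carrier L" if "s \<in> ?A" "x \<in> carrier L" for s x
    using that by (auto simp: A Bij_def bij_betw_def)
  have gf: "g (f t) = t" if "t \<in> ?B" for t
  proof (rule extensionalityI[of _ "carrier M"])
    show "t \<in> extensional (carrier M)" using that by (simp add: B Bij_def)
  qed (auto simp: g_def f_def jk kM tM[OF that])
  have fg: "f (g s) = s" if "s \<in> ?A" for s
  proof (rule extensionalityI[of _ "carrier L"])
    show "s \<in> extensional (carrier L)" using that by (simp add: A Bij_def)
  qed (auto simp: g_def f_def kj jL sL[OF that])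
  have "bij_betw f ?B ?A"
    by (rule bij_betw_byWitness[where f' = g]) (use gf fg fA gB in auto)
  moreover have "f \<in> hom (Aut_ext F M (j \<circ> h)) (Aut_ext F L h)"
  proof (rule homI)
    fix t assume "t \<in> ?B" then show "f t \<in> ?A" by (rule fA)
  next
    fix t u assume tu: "t \<in> ?B" "u \<in> ?B"
    have "t \<in> Bij (carrier M)" "u \<in> Bij (carrier M)" "f t \<in> Bij (carrier L)" "f u \<in> Bij (carrier L)"
      using tu fA A B by blast+
    moreover have "f (compose (carrier M) t u) = compose (carrier L) (f t) (f u)"
      using tu by (auto simp: f_def compose_def jk kM jL tM fun_eq_iff)
    ultimately show "f (t \<otimes>\<^bsub>Aut_ext F M (j \<circ> h)\<^esub> u) = f t \<otimes>\<^bsub>Aut_ext F L h\<^esub> f u"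
      by (simp add: Aut_ext_def BijGroup_def)
  qed
  ultimately show ?thesis by (auto simp: is_iso_def iso_def)
qed

lemma is_ext_with_Aut_image:
  fixes F :: "'a ring" and L :: "'b ring" and j :: "'b \<Rightarrow> 'c"
  assumes ext: "is_ext_with_Aut F L h n H" and inj: "inj_on j (carrier L)"
  shows "\<exists>L' :: 'c ring. is_ext_with_Aut F L' (j \<circ> h) n H"
proof -
  interpret F: field F using ext by (simp add: is_ext_with_Aut_def field_ext_def)
  interpret L: field L using ext by (simp add: is_ext_with_Aut_def field_ext_def)
  have h: "h \<in> ring_hom F L" using ext by (simp add: is_ext_with_Aut_def field_ext_def)
  interpret h: ring_hom_ring F L h
    using h by (intro ring_hom_ringI2) (auto simp: F.ring_axioms L.ring_axioms)
  have K: "subfield (h ` carrier F) L"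
    using h.img_is_subfield(2)[OF F.carrier_is_subfield] L.one_not_zero by simp
  define M where "M = image_ring j L"
  have iso: "j \<in> ring_iso L M" unfolding M_def by (rule inj_imp_image_ring_iso[OF inj])
  then have j: "j \<in> ring_hom L M" by (simp add: ring_iso_def)
  interpret M: field M unfolding M_def by (rule L.inj_imp_image_ring_is_field[OF inj])
  interpret j: ring_hom_ring L M j
    using j by (intro ring_hom_ringI2) (auto simp: M.ring_axioms L.ring_axioms)
  have "field_ext F M (j \<circ> h)"
    using ring_hom_trans[OF h j] by (simp add: field_ext_def F.field_axioms M.field_axioms)
  moreover have "ext_degree F M (j \<circ> h) n"
  proof -
    have "L.dimension n (h ` carrier F) (carrier L)"
      using ext by (simp add: is_ext_with_Aut_def ext_degree_def)
    from j.inj_hom_dimension[OF K M.one_not_zero inj this]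
    have "M.dimension n (j ` h ` carrier F) (j ` carrier L)" .
    moreover have "j ` carrier L = carrier M" using iso by (simp add: ring_iso_def bij_betw_def)
    ultimately show ?thesis by (simp add: ext_degree_def image_comp)
  qed
  moreover have "Aut_ext F M (j \<circ> h) \<cong> H"
  proof (rule iso_trans)
    show "Aut_ext F M (j \<circ> h) \<cong> Aut_ext F L h"
      by (rule Aut_ext_image_iso[OF L.ring_axioms M.ring_axioms iso]) auto
    show "Aut_ext F L h \<cong> H" using ext by (simp add: is_ext_with_Aut_def)
  qed
  ultimately show ?thesis by (auto simp: is_ext_with_Aut_def)
qed

theorem has_ext_with_AutI:
  fixes F :: "'a ring" and L :: "'b ring"
  assumes "is_ext_with_Aut F L h n H"
  shows "has_ext_with_Aut F n H"
  using ext_degree_inj_on_lists is_ext_with_Aut_image assms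
  unfolding has_ext_with_Aut_def is_ext_with_Aut_def by metis


section \<open>The formula attached to a finite group and a degree\<close>

text \<open>The formula must depend on \<open>H\<close> and \<open>n\<close> only, in particular not on the field. In a statement
  of the form ``there is a formula such that for every field \<open>F\<close> of type \<open>'a ring\<close>'' the witness
  could still vary with the type \<open>'a\<close>. We therefore fix the formula by a constant whose type does
  not mention \<open>'a\<close>: an arbitrary formula in \<open>x\<^sub>1, \<dots>, x\<^sub>n\<close> with the required property for the
  countable fields. The definition asserts neither that such a formula exists nor anything about
  fields on other types. The choice is harmless: by the downward Loewenheim--Skolem theorem,
  formulas that agree in this sense on countable fields agree on all fields.\<close>

definition ext_formula :: "'h monoid \<Rightarrow> nat \<Rightarrow> rform" (\<open>\<epsilon>\<close>) where
  "\<epsilon> H n = (SOME p. free_vars p \<subseteq> {1..n} \<and>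
     (\<forall>F :: nat ring. field F \<longrightarrow> (F \<Turnstile>\<^sub>R REx_upto n p \<longleftrightarrow> has_ext_with_Aut F n H)))"

end

(* An extension of degree n is given by the structure constants of a multiplication on F^n, and its
   automorphisms over F are the n x n matrices that respect this multiplication. That the algebra is
   a field, and that its automorphisms are exactly m given distinct matrices which multiply according
   to the table of H, is therefore a first-order statement about the constants and the matrices; its
   existential closure is a sentence with the required property over every field.
   The formula \<epsilon> H n is by definition only correct over countable fields. By the downward
   Loewenheim-Skolem theorem, F satisfies the same sentences as some countable field, and there
   \<epsilon> H n agrees with the explicit sentence. *)

theory Submission
  imports Defs "HOL-Library.Countable_Set"
begin

section \<open>Evaluation and closure of formulas\<close>

text \<open>Everything is elementary because n is fixed: a vector of F^n is n variables, so a
  quantifier over the extension, or over all n x n matrices, is a finite block of quantifiers over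
  F. The second kind is what rules out automorphisms beyond the m listed ones. The unit vector u
  encodes the embedding of F, namely a |-> a u; as matrices act linearly, a map given by a matrix
  fixes F as soon as it fixes u. The data do not fit into x_1, ..., x_n: there are n^3 structure
  constants, n coordinates of u and m n^2 matrix entries. Hence all of them are bound inside the
  formula itself, by an existential closure. Two points of typing shape the proof. The coordinate
  algebra has elements of type \<open>nat \<Rightarrow> 'a\<close>, while extensions are sought on
  \<open>'a list\<close>; \<open>has_ext_with_AutI\<close> bridges the gap. And the explicit
  sentence mentions no field type, so one and the same sentence can be evaluated over fields on
  \<open>nat\<close> and over fields on \<open>'a\<close>.\<close>

lemma rterm_val_cong:
  "(\<And>i. i \<in> rterm_vars t \<Longrightarrow> e i = e' i) \<Longrightarrow> rterm_val R e t = rterm_val R e' t"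
  by (induction t) auto

lemma rterm_val_closed:
  "ring R \<Longrightarrow> range e \<subseteq> carrier R \<Longrightarrow> rterm_val R e t \<in> carrier R"
  by (induction t) (auto intro: ring.ring_simprules)

lemma holds_cong:
  "(\<And>i. i \<in> free_vars p \<Longrightarrow> e i = e' i) \<Longrightarrow> holds R e p \<longleftrightarrow> holds R e' p"
proof (induction p arbitrary: e e')
  case (REq s t)
  have "rterm_val R e s = rterm_val R e' s" "rterm_val R e t = rterm_val R e' t"
    by (auto intro!: rterm_val_cong REq)
  then show ?case by simp
next
  case (RNeg p)
  have "holds R e p = holds R e' p" by (rule RNeg.IH) (simp add: RNeg.prems)
  then show ?case by simp
next
  case (RConj p q)
  have "holds R e p = holds R e' p" "holds R e q = holds R e' q"
    by (rule RConj.IH; simp add: RConj.prems)+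
  then show ?case by simp
next
  case (REx i p)
  have "holds R (e(i := a)) p \<longleftrightarrow> holds R (e'(i := a)) p" for a
    by (rule REx.IH) (use REx.prems in auto)
  then show ?case by simp
qed

lemma finite_rterm_vars [simp]: "finite (rterm_vars t)"
  by (induction t) auto

lemma finite_free_vars [simp]: "finite (free_vars p)"
  by (induction p) auto

lemma free_vars_foldr_REx: "free_vars (foldr REx is p) = free_vars p - set is"
  by (induction "is") auto

lemma holds_foldr_REx:
  "holds R e (foldr REx is p) \<longleftrightarrow>
     (\<exists>e'. (\<forall>i. i \<notin> set is \<longrightarrow> e' i = e i) \<and> e' ` set is \<subseteq> carrier R \<and> holds R e' p)"
proof (induction "is" arbitrary: e)
  case Nil
  have "(\<forall>i. e' i = e i) \<longleftrightarrow> e' = e" for e' :: "nat \<Rightarrow> 'a" by auto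
  then show ?case by simp
next
  case (Cons i "is")
  show ?case
  proof
    assume "holds R e (foldr REx (i # is) p)"
    then obtain a where a: "a \<in> carrier R" "holds R (e(i := a)) (foldr REx is p)" by auto
    then obtain e' where e': "\<forall>k. k \<notin> set is \<longrightarrow> e' k = (e(i := a)) k"
      "e' ` set is \<subseteq> carrier R" "holds R e' p"
      using Cons.IH by blast
    \<comment> \<open>If \<open>i\<close> occurs again in \<open>is\<close>, the inner quantifier
      overrides \<open>a\<close>.\<close>
    moreover have "e' i \<in> carrier R" using e' a by (cases "i \<in> set is") auto
    ultimately show "\<exists>e'. (\<forall>k. k \<notin> set (i # is) \<longrightarrow> e' k = e k) \<and>
        e' ` set (i # is) \<subseteq> carrier R \<and> holds R e' p"
      by (intro exI[of _ e']) auto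
  next
    assume "\<exists>e'. (\<forall>k. k \<notin> set (i # is) \<longrightarrow> e' k = e k) \<and>
        e' ` set (i # is) \<subseteq> carrier R \<and> holds R e' p"
    then obtain e' where e': "\<forall>k. k \<notin> set (i # is) \<longrightarrow> e' k = e k"
        "e' ` set (i # is) \<subseteq> carrier R" "holds R e' p" by blast
    then have "holds R (e(i := e' i)) (foldr REx is p)"
      by (subst Cons.IH) (intro exI[of _ e'], auto)
    then show "holds R e (foldr REx (i # is) p)" using e' by auto
  qed
qed

text \<open>The free variables lie among those quantified, so a witness can be merged with any
  surrounding assignment.\<close>

lemma models_REx_upto_iff:
  assumes "carrier R \<noteq> {}" and "free_vars p \<subseteq> {1..n}"
  shows "R \<Turnstile>\<^sub>R REx_upto n p \<longleftrightarrow> (\<exists>e. range e \<subseteq> carrier R \<and> holds R e p)"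
proof
  assume M: "R \<Turnstile>\<^sub>R REx_upto n p"
  obtain z where z: "z \<in> carrier R" using assms(1) by blast
  then have "holds R (\<lambda>_. z) (REx_upto n p)"
    using M by (auto simp: models_def)
  then obtain e' where e': "\<forall>i. i \<notin> set [1..<Suc n] \<longrightarrow> e' i = z"
      "e' ` set [1..<Suc n] \<subseteq> carrier R" "holds R e' p"
    unfolding REx_upto_def holds_foldr_REx by blast
  have "e' i \<in> carrier R" for i
    using e' z by (cases "i \<in> set [1..<Suc n]") (blast, metis)
  then show "\<exists>e. range e \<subseteq> carrier R \<and> holds R e p" using e'(3) by blast
next
  assume "\<exists>e. range e \<subseteq> carrier R \<and> holds R e p"
  then obtain e where e: "range e \<subseteq> carrier R" "holds R e p" by blast
  show "R \<Turnstile>\<^sub>R REx_upto n p"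
    unfolding models_def REx_upto_def holds_foldr_REx
  proof (intro allI impI)
    fix d :: "nat \<Rightarrow> 'a"
    let ?e = "\<lambda>i. if i \<in> {1..n} then e i else d i"
    have "holds R ?e p \<longleftrightarrow> holds R e p" by (rule holds_cong) (use assms(2) in auto)
    then have "holds R ?e p" using e(2) by simp
    then show "\<exists>e'. (\<forall>i. i \<notin> set [1..<Suc n] \<longrightarrow> e' i = d i) \<and>
        e' ` set [1..<Suc n] \<subseteq> carrier R \<and> holds R e' p"
      using e(1) by (intro exI[of _ ?e]) auto
  qed
qed

text \<open>The addresses of the variables in the explicit formula are not confined to 1, ..., n.
  Binding all of them gives a formula that meets the condition on the free variables of
  \<epsilon>.\<close>

definition ex_closure :: "rform \<Rightarrow> rform" where
  "ex_closure p = foldr REx (sorted_list_of_set (free_vars p)) p"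

lemma free_vars_ex_closure [simp]: "free_vars (ex_closure p) = {}"
  by (simp add: ex_closure_def free_vars_foldr_REx)

lemma models_ex_closure:
  assumes "carrier R \<noteq> {}"
  shows "R \<Turnstile>\<^sub>R REx_upto n (ex_closure p) \<longleftrightarrow> (\<exists>e. range e \<subseteq> carrier R \<and> holds R e p)"
proof -
  obtain z where z: "z \<in> carrier R" using assms by blast
  have "(\<exists>e. range e \<subseteq> carrier R \<and> holds R e (ex_closure p)) \<longleftrightarrow>
      (\<exists>e. range e \<subseteq> carrier R \<and> holds R e p)"
  proof
    assume "\<exists>e. range e \<subseteq> carrier R \<and> holds R e (ex_closure p)"
    then obtain e e' where e: "range e \<subseteq> carrier R" "\<forall>i. i \<notin> free_vars p \<longrightarrow> e' i = e i"
      "e' ` free_vars p \<subseteq> carrier R" "holds R e' p"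
      unfolding ex_closure_def holds_foldr_REx by auto
    then have "e' i \<in> carrier R" for i by (cases "i \<in> free_vars p") (blast, force)
    then show "\<exists>e. range e \<subseteq> carrier R \<and> holds R e p" using e by blast
  next
    assume "\<exists>e. range e \<subseteq> carrier R \<and> holds R e p"
    then show "\<exists>e. range e \<subseteq> carrier R \<and> holds R e (ex_closure p)"
      unfolding ex_closure_def holds_foldr_REx by force
  qed
  then show ?thesis using models_REx_upto_iff[OF assms, of "ex_closure p" n] by simp
qed

section \<open>Invariance of truth under ring isomorphisms\<close>

text \<open>Preservation of zero is a separate hypothesis because \<open>ring_hom\<close> only
  speaks of one, sums and products.\<close>

lemma rterm_val_ring_iso:
  assumes "j \<in> ring_hom R S" "ring R" "range e \<subseteq> carrier R" "j \<zero>\<^bsub>R\<^esub> = \<zero>\<^bsub>S\<^esub>"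
  shows "rterm_val S (j \<circ> e) t = j (rterm_val R e t)"
  using assms by (induction t) (simp_all add: ring_hom_def rterm_val_closed)

text \<open>Injectivity of \<open>j\<close> reflects equations, and surjectivity carries witnesses
  of quantifiers back.\<close>

lemma holds_ring_iso:
  assumes j: "j \<in> ring_iso R S" and R: "ring R" and S: "ring S" and e: "range e \<subseteq> carrier R"
  shows "holds S (j \<circ> e) p \<longleftrightarrow> holds R e p"
proof -
  have jh: "j \<in> ring_hom R S" and jb: "bij_betw j (carrier R) (carrier S)"
    using j by (auto simp: ring_iso_def)
  have j0: "j \<zero>\<^bsub>R\<^esub> = \<zero>\<^bsub>S\<^esub>" by (rule ring_hom_zero[OF jh R S])
  show ?thesis
    using e
  proof (induction p arbitrary: e)
    case (REq s t)
    have "inj_on j (carrier R)" using jb by (simp add: bij_betw_def)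
    then show ?case
      unfolding holds.simps rterm_val_ring_iso[OF jh R REq j0]
      by (rule inj_on_eq_iff) (rule rterm_val_closed[OF R REq])+
  next
    case (REx i p)
    have "holds S ((j \<circ> e)(i := j a)) p \<longleftrightarrow> holds R (e(i := a)) p" if "a \<in> carrier R" for a
    proof -
      have "range (e(i := a)) \<subseteq> carrier R" using REx.prems that by auto
      then have "holds S (j \<circ> e(i := a)) p \<longleftrightarrow> holds R (e(i := a)) p" by (rule REx.IH)
      then show ?thesis by (simp add: fun_upd_comp)
    qed
    moreover have "carrier S = j ` carrier R" using jb by (simp add: bij_betw_def)
    ultimately show ?case by (simp del: fun_upd_apply o_apply add: comp_def)
  qed simp_all
qed

lemma models_ring_iso:
  assumes j: "j \<in> ring_iso R S" and R: "ring R" and S: "ring S" and p: "free_vars p \<subseteq> {1..n}"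
  shows "S \<Turnstile>\<^sub>R REx_upto n p \<longleftrightarrow> R \<Turnstile>\<^sub>R REx_upto n p"
proof -
  have jb: "bij_betw j (carrier R) (carrier S)" using j by (auto simp: ring_iso_def)
  have R0: "carrier R \<noteq> {}" and S0: "carrier S \<noteq> {}"
    using ring.ring_simprules(2)[OF R] ring.ring_simprules(2)[OF S] by auto
  have "(\<exists>e. range e \<subseteq> carrier S \<and> holds S e p) \<longleftrightarrow> (\<exists>e. range e \<subseteq> carrier R \<and> holds R e p)"
  proof
    assume "\<exists>e. range e \<subseteq> carrier S \<and> holds S e p"
    then obtain e where e: "range e \<subseteq> carrier S" "holds S e p" by blast
    define d where "d = inv_into (carrier R) j \<circ> e"
    have im: "j ` carrier R = carrier S" using jb by (simp add: bij_betw_def)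
    have 1: "j (d i) = e i" for i
      unfolding d_def comp_def by (rule f_inv_into_f) (use e(1) im in blast)
    have 2: "d i \<in> carrier R" for i
      unfolding d_def comp_def by (rule inv_into_into) (use e(1) im in blast)
    have "j \<circ> d = e" using 1 by auto
    moreover have "range d \<subseteq> carrier R" using 2 by blast
    ultimately have "holds R d p" using holds_ring_iso[OF j R S, of d p] e by simp
    then show "\<exists>e. range e \<subseteq> carrier R \<and> holds R e p" using \<open>range d \<subseteq> carrier R\<close> by blast
  next
    assume "\<exists>e. range e \<subseteq> carrier R \<and> holds R e p"
    then obtain e where e: "range e \<subseteq> carrier R" "holds R e p" by blast
    then have "range (j \<circ> e) \<subseteq> carrier S" using jb by (auto simp: bij_betw_def)
    then show "\<exists>e. range e \<subseteq> carrier S \<and> holds S e p"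
      using holds_ring_iso[OF j R S e(1), of p] e(2) by blast
  qed
  then show ?thesis by (simp add: models_REx_upto_iff[OF R0 p] models_REx_upto_iff[OF S0 p])
qed

section \<open>Countable elementary substructures\<close>

instance rterm :: countable by countable_datatype
instance rform :: countable by countable_datatype

text \<open>Terms built from Skolem functions: as they form a countable type, the hull is countable.\<close>

datatype skolem_tree = SkolemTree rform nat "skolem_tree list"

instance skolem_tree :: countable by countable_datatype

text \<open>Arguments of Skolem functions are finite lists, which keeps the trees finite and hence
  countably many. Padding with \<open>z\<close> yields the total assignment that
  \<open>holds\<close> expects.\<close>

definition list_env :: "'a \<Rightarrow> 'a list \<Rightarrow> nat \<Rightarrow> 'a" where
  "list_env z xs i = (if i < length xs then xs ! i else z)"

text \<open>The default zero makes the function total with values in the carrier, so every tree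
  denotes an element.\<close>

definition skolem_fun :: "('a, 'c) ring_scheme \<Rightarrow> rform \<Rightarrow> nat \<Rightarrow> 'a list \<Rightarrow> 'a" where
  "skolem_fun R p i xs =
     (if \<exists>a \<in> carrier R. holds R ((list_env \<zero>\<^bsub>R\<^esub> xs)(i := a)) p
      then SOME a. a \<in> carrier R \<and> holds R ((list_env \<zero>\<^bsub>R\<^esub> xs)(i := a)) p else \<zero>\<^bsub>R\<^esub>)"

primrec skolem_val :: "('a, 'c) ring_scheme \<Rightarrow> skolem_tree \<Rightarrow> 'a" where
  "skolem_val R (SkolemTree p i ts) = skolem_fun R p i (map (skolem_val R) ts)"

definition skolem_hull :: "('a, 'c) ring_scheme \<Rightarrow> 'a set" where
  "skolem_hull R = range (skolem_val R)"

lemma countable_skolem_hull: "countable (skolem_hull R)"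
  by (simp add: skolem_hull_def)

lemma skolem_fun_closed: "ring R \<Longrightarrow> skolem_fun R p i xs \<in> carrier R"
  unfolding skolem_fun_def by (auto intro: ring.ring_simprules someI2_ex)

lemma skolem_hull_subset: "ring R \<Longrightarrow> skolem_hull R \<subseteq> carrier R"
proof -
  assume "ring R"
  then have "skolem_val R t \<in> carrier R" for t by (cases t) (simp add: skolem_fun_closed)
  then show ?thesis by (auto simp: skolem_hull_def)
qed

text \<open>The Tarski-Vaught criterion. Only finitely many values of \<open>e\<close> matter for
  \<open>p\<close>, each is the value of a tree, and the tree with root \<open>p\<close>,
  \<open>i\<close> and these subtrees evaluates to a witness.\<close>

lemma skolem_hull_witness:
  assumes e: "range e \<subseteq> skolem_hull R" and a: "a \<in> carrier R" "holds R (e(i := a)) p"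
  shows "\<exists>b \<in> skolem_hull R \<inter> carrier R. holds R (e(i := b)) p"
proof -
  obtain N where N: "\<forall>k \<in> free_vars p. k < N"
    using finite_nat_set_iff_bounded finite_free_vars by metis
  have "\<exists>t. skolem_val R t = e k" for k using e by (auto simp: skolem_hull_def image_iff subset_iff) metis
  then obtain t where t: "\<And>k. skolem_val R (t k) = e k" by metis
  define ts where "ts = map t [0..<N]"
  let ?xs = "map (skolem_val R) ts"
  have env: "list_env \<zero>\<^bsub>R\<^esub> ?xs k = e k" if "k < N" for k
    using that by (simp add: list_env_def ts_def t)
  have *: "holds R ((list_env \<zero>\<^bsub>R\<^esub> ?xs)(i := b)) p \<longleftrightarrow> holds R (e(i := b)) p" for b
    by (rule holds_cong) (use N env in auto)
  have "\<exists>b. b \<in> carrier R \<and> holds R ((list_env \<zero>\<^bsub>R\<^esub> ?xs)(i := b)) p" using a * by blast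
  then have "skolem_fun R p i ?xs \<in> carrier R \<and> holds R ((list_env \<zero>\<^bsub>R\<^esub> ?xs)(i := skolem_fun R p i ?xs)) p"
    unfolding skolem_fun_def using someI_ex[of "\<lambda>b. b \<in> carrier R \<and> holds R ((list_env \<zero>\<^bsub>R\<^esub> ?xs)(i := b)) p"]
    by auto
  moreover have "skolem_fun R p i ?xs = skolem_val R (SkolemTree p i ts)" by simp
  ultimately show ?thesis unfolding * skolem_hull_def by (metis IntI rangeI)
qed

lemma rterm_val_restrict: "rterm_val (R\<lparr>carrier := S\<rparr>) e t = rterm_val R e t"
  by (induction t) auto

text \<open>The hull is an elementary substructure: in the induction only the quantifier can fail,
  and there a witness in \<open>R\<close> is replaced by one in the hull.\<close>

lemma holds_skolem_hull:
  assumes "ring R" "range e \<subseteq> skolem_hull R"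
  shows "holds (R\<lparr>carrier := skolem_hull R\<rparr>) e p \<longleftrightarrow> holds R e p"
  using assms(2)
proof (induction p arbitrary: e)
  case (REx i p)
  have "holds (R\<lparr>carrier := skolem_hull R\<rparr>) (e(i := a)) p \<longleftrightarrow> holds R (e(i := a)) p"
    if "a \<in> skolem_hull R" for a
    by (rule REx.IH) (use REx.prems that in auto)
  then show ?case
    using skolem_hull_witness[OF REx.prems, of _ i p] skolem_hull_subset[OF assms(1)]
    by (auto dest: subsetD) blast
qed (simp_all add: rterm_val_restrict)

section \<open>The hull as a countable subfield\<close>

text \<open>The hull is definably closed: if \<open>a\<close> is the only solution of a formula with
  parameters in the hull, then the witness found in the hull is \<open>a\<close>. Variable 0 stands
  for \<open>x\<close>, variable 1 for \<open>y\<close> and variable 2 for the solution.\<close>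

lemma skolem_hull_definable:
  assumes "ring R" "x \<in> skolem_hull R" "y \<in> skolem_hull R" "a \<in> carrier R"
    and "\<And>b. b \<in> carrier R \<Longrightarrow> holds R ((\<lambda>k. if k = 0 then x else y)(2 := b)) p \<longleftrightarrow> b = a"
  shows "a \<in> skolem_hull R"
  using skolem_hull_witness[of "\<lambda>k. if k = 0 then x else y" R a 2 p] assms by auto

text \<open>The trees contain no ring operations; closure under each operation follows because its
  result is defined by an equation.\<close>

lemma subfield_skolem_hull:
  assumes "field R"
  shows "subfield (skolem_hull R) R"
proof -
  interpret R: field R by fact
  note R = R.ring_axioms
  have sub: "skolem_hull R \<subseteq> carrier R" by (rule skolem_hull_subset[OF R])
  \<comment> \<open>Any tree without subtrees shows that the hull is non-empty; its value serves as
    a dummy parameter in the definition of one.\<close>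
  have "skolem_val R (SkolemTree (REq (RVar 0) (RVar 0)) 0 []) \<in> skolem_hull R"
    unfolding skolem_hull_def by blast
  then obtain w where w: "w \<in> skolem_hull R" by blast
  have one: "\<one>\<^bsub>R\<^esub> \<in> skolem_hull R"
    by (rule skolem_hull_definable[OF R w w, where p = "REq (RVar 2) ROne"]) auto
  have add: "x \<oplus>\<^bsub>R\<^esub> y \<in> skolem_hull R" if "x \<in> skolem_hull R" "y \<in> skolem_hull R" for x y
    by (rule skolem_hull_definable[OF R that, where p = "REq (RVar 2) (RAdd (RVar 0) (RVar 1))"])
       (use that sub in auto)
  have mult: "x \<otimes>\<^bsub>R\<^esub> y \<in> skolem_hull R" if "x \<in> skolem_hull R" "y \<in> skolem_hull R" for x y
    by (rule skolem_hull_definable[OF R that, where p = "REq (RVar 2) (RMult (RVar 0) (RVar 1))"])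
       (use that sub in auto)
  have minus: "\<ominus>\<^bsub>R\<^esub> x \<in> skolem_hull R" if "x \<in> skolem_hull R" for x
  proof (rule skolem_hull_definable[OF R that that, where p = "REq (RAdd (RVar 2) (RVar 0)) RZero"])
    show "\<ominus>\<^bsub>R\<^esub> x \<in> carrier R" using that sub by auto
    fix b assume "b \<in> carrier R"
    then show "holds R ((\<lambda>k. if k = 0 then x else x)(2 := b)) (REq (RAdd (RVar 2) (RVar 0)) RZero)
        \<longleftrightarrow> b = \<ominus>\<^bsub>R\<^esub> x"
      using that sub R.l_neg R.minus_equality by auto
  qed
  have inv: "inv\<^bsub>R\<^esub> x \<in> skolem_hull R" if "x \<in> skolem_hull R" "x \<noteq> \<zero>\<^bsub>R\<^esub>" for x
  proof (rule skolem_hull_definable[OF R that(1) that(1), where p = "REq (RMult (RVar 2) (RVar 0)) ROne"])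
    have x: "x \<in> Units R" using that sub R.field_Units by auto
    then show "inv\<^bsub>R\<^esub> x \<in> carrier R" by simp
    fix b assume "b \<in> carrier R"
    then show "holds R ((\<lambda>k. if k = 0 then x else x)(2 := b)) (REq (RMult (RVar 2) (RVar 0)) ROne)
        \<longleftrightarrow> b = inv\<^bsub>R\<^esub> x"
      using x R.Units_l_inv R.inv_unique' R.m_comm R.Units_closed by (auto simp: R.comm_inv_char)
  qed
  show ?thesis
    by (rule R.subfieldI') (auto intro!: R.subringI sub one add mult minus inv)
qed

theorem countable_elementary_field:
  fixes F :: "'a ring"
  assumes "field F"
  shows "\<exists>F' :: nat ring. field F' \<and>
    (\<forall>n p. free_vars p \<subseteq> {1..n} \<longrightarrow> (F' \<Turnstile>\<^sub>R REx_upto n p \<longleftrightarrow> F \<Turnstile>\<^sub>R REx_upto n p))"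
proof -
  interpret F: field F by fact
  let ?S = "skolem_hull F"
  define G where "G = F\<lparr>carrier := ?S\<rparr>"
  have "field G" unfolding G_def by (rule F.subfield_iff(2)[OF subfield_skolem_hull[OF assms]])
  then interpret G: field G .
  \<comment> \<open>An injection into \<open>nat\<close> instead of an enumeration: the hull may be
    finite, and the copy of the field may occupy only part of \<open>nat\<close>.\<close>
  obtain j :: "'a \<Rightarrow> nat" where "inj_on j ?S" using countable_skolem_hull[of F] by (auto simp: countable_def)
  then have j: "inj_on j (carrier G)" by (simp add: G_def)
  have iso: "j \<in> ring_iso G (image_ring j G)" by (rule inj_imp_image_ring_iso[OF j])
  have fld: "field (image_ring j G)" by (rule G.inj_imp_image_ring_is_field[OF j])
  have "G \<Turnstile>\<^sub>R REx_upto n p \<longleftrightarrow> F \<Turnstile>\<^sub>R REx_upto n p" if p: "free_vars p \<subseteq> {1..n}" for n p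
  proof -
    have sub: "?S \<subseteq> carrier F" by (rule skolem_hull_subset[OF F.ring_axioms])
    have G: "holds G e q \<longleftrightarrow> holds F e q" if "range e \<subseteq> ?S" for e q
      unfolding G_def by (rule holds_skolem_hull[OF F.ring_axioms that])
    \<comment> \<open>\<open>models\<close> quantifies over assignments into different carriers for
      \<open>G\<close> and \<open>F\<close>. As the sentence is closed, both sides reduce to the one
      assignment \<open>e0\<close>, which lies in the hull.\<close>
    have closed: "free_vars (REx_upto n p) = {}"
      using p by (auto simp: REx_upto_def free_vars_foldr_REx)
    have F: "holds F e (REx_upto n p) \<longleftrightarrow> holds F e' (REx_upto n p)" for e e'
      by (rule holds_cong) (simp add: closed)
    define e0 where "e0 = (\<lambda>_ :: nat. \<one>\<^bsub>G\<^esub>)"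
    have e0: "range e0 \<subseteq> ?S" using G.one_closed by (auto simp: e0_def G_def)
    have "G \<Turnstile>\<^sub>R REx_upto n p \<longleftrightarrow> holds F e0 (REx_upto n p)"
      unfolding models_def using G F[of _ e0] e0 by (simp add: G_def) blast
    moreover have "F \<Turnstile>\<^sub>R REx_upto n p \<longleftrightarrow> holds F e0 (REx_upto n p)"
      unfolding models_def using F[of _ e0] e0 sub by blast
    ultimately show ?thesis by simp
  qed
  then show ?thesis
    using fld models_ring_iso[OF iso G.ring_axioms cring.axioms(1)[OF fieldE(1)[OF fld]]]
    by (intro exI[of _ "image_ring j G"]) simp
qed

section \<open>Algebras given by structure constants\<close>

text \<open>Extensional functions, so that vectors with equal coordinates are equal and the algebra
  can use HOL equality.\<close>

definition vecs :: "('a, 'k) ring_scheme \<Rightarrow> nat \<Rightarrow> (nat \<Rightarrow> 'a) set" where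
  "vecs F n = {..<n} \<rightarrow>\<^sub>E carrier F"

definition vec_add :: "('a, 'k) ring_scheme \<Rightarrow> nat \<Rightarrow> (nat \<Rightarrow> 'a) \<Rightarrow> (nat \<Rightarrow> 'a) \<Rightarrow> nat \<Rightarrow> 'a" where
  "vec_add F n x y = (\<lambda>k \<in> {..<n}. x k \<oplus>\<^bsub>F\<^esub> y k)"

text \<open>The scalar comes last so that \<open>smult_vec F n u\<close> is the embedding of F into
  the algebra with unit \<open>u\<close>.\<close>

definition smult_vec :: "('a, 'k) ring_scheme \<Rightarrow> nat \<Rightarrow> (nat \<Rightarrow> 'a) \<Rightarrow> 'a \<Rightarrow> nat \<Rightarrow> 'a" where
  "smult_vec F n x a = (\<lambda>k \<in> {..<n}. a \<otimes>\<^bsub>F\<^esub> x k)"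

text \<open>The row vector \<open>x\<close> times the matrix with rows \<open>M i\<close>: the
  linear map sending the i-th unit vector to \<open>M i\<close>.\<close>

definition lincomb ::
    "('a, 'k) ring_scheme \<Rightarrow> nat \<Rightarrow> (nat \<Rightarrow> nat \<Rightarrow> 'a) \<Rightarrow> (nat \<Rightarrow> 'a) \<Rightarrow> nat \<Rightarrow> 'a" where
  "lincomb F n M x = (\<lambda>k \<in> {..<n}. finsum F (\<lambda>i. x i \<otimes>\<^bsub>F\<^esub> M i k) {..<n})"

definition unit_vec :: "('a, 'k) ring_scheme \<Rightarrow> nat \<Rightarrow> nat \<Rightarrow> nat \<Rightarrow> 'a" where
  "unit_vec F n i = (\<lambda>k \<in> {..<n}. if i = k then \<one>\<^bsub>F\<^esub> else \<zero>\<^bsub>F\<^esub>)"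

text \<open>The bilinear product for which \<open>c i j\<close> is the product of the unit vectors i
  and j.\<close>

definition vec_mult :: "('a, 'k) ring_scheme \<Rightarrow> nat \<Rightarrow> (nat \<Rightarrow> nat \<Rightarrow> nat \<Rightarrow> 'a) \<Rightarrow>
    (nat \<Rightarrow> 'a) \<Rightarrow> (nat \<Rightarrow> 'a) \<Rightarrow> nat \<Rightarrow> 'a" where
  "vec_mult F n c x y = lincomb F n (\<lambda>i. lincomb F n (c i) y) x"

definition coord_algebra :: "('a, 'k) ring_scheme \<Rightarrow> nat \<Rightarrow> (nat \<Rightarrow> nat \<Rightarrow> nat \<Rightarrow> 'a) \<Rightarrow>
    (nat \<Rightarrow> 'a) \<Rightarrow> (nat \<Rightarrow> 'a) ring" where
  "coord_algebra F n c u =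
     \<lparr>carrier = vecs F n, monoid.mult = vec_mult F n c, one = u,
      ring.zero = (\<lambda>k \<in> {..<n}. \<zero>\<^bsub>F\<^esub>), ring.add = vec_add F n\<rparr>"

lemma coord_algebra_simps [simp]:
  "carrier (coord_algebra F n c u) = vecs F n"
  "x \<otimes>\<^bsub>coord_algebra F n c u\<^esub> y = vec_mult F n c x y"
  "\<one>\<^bsub>coord_algebra F n c u\<^esub> = u"
  "\<zero>\<^bsub>coord_algebra F n c u\<^esub> = (\<lambda>k \<in> {..<n}. \<zero>\<^bsub>F\<^esub>)"
  "x \<oplus>\<^bsub>coord_algebra F n c u\<^esub> y = vec_add F n x y"
  by (simp_all add: coord_algebra_def)

lemma vecs_eqI:
  "x \<in> vecs F n \<Longrightarrow> y \<in> vecs F n \<Longrightarrow> (\<And>k. k < n \<Longrightarrow> x k = y k) \<Longrightarrow> x = y"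
  unfolding vecs_def by (rule PiE_ext) auto

lemma vecs_nth [intro]: "x \<in> vecs F n \<Longrightarrow> k < n \<Longrightarrow> x k \<in> carrier F"
  by (auto simp: vecs_def)

lemma vecsI [intro]: "(\<And>k. k < n \<Longrightarrow> f k \<in> carrier F) \<Longrightarrow> (\<lambda>k \<in> {..<n}. f k) \<in> vecs F n"
  by (auto simp: vecs_def)

section \<open>Linear algebra in coordinates\<close>

context field
begin

lemma vec_add_closed [simp, intro]: "x \<in> vecs R n \<Longrightarrow> y \<in> vecs R n \<Longrightarrow> vec_add R n x y \<in> vecs R n"
  unfolding vec_add_def by (intro vecsI) auto

lemma smult_vec_closed [simp, intro]: "x \<in> vecs R n \<Longrightarrow> a \<in> carrier R \<Longrightarrow> smult_vec R n x a \<in> vecs R n"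
  unfolding smult_vec_def by (intro vecsI) auto

lemma unit_vec_closed [simp, intro]: "unit_vec R n i \<in> vecs R n"
  unfolding unit_vec_def by (intro vecsI) auto

lemma zero_vec_closed [simp, intro]: "(\<lambda>k \<in> {..<n}. \<zero>) \<in> vecs R n"
  by (intro vecsI) auto

lemma lincomb_closed [simp, intro]:
  "(\<And>i. i < n \<Longrightarrow> M i \<in> vecs R n) \<Longrightarrow> x \<in> vecs R n \<Longrightarrow> lincomb R n M x \<in> vecs R n"
  unfolding lincomb_def by (intro vecsI finsum_closed) auto

lemma vec_mult_closed [simp, intro]:
  "(\<And>i j. i < n \<Longrightarrow> j < n \<Longrightarrow> c i j \<in> vecs R n) \<Longrightarrow> x \<in> vecs R n \<Longrightarrow> y \<in> vecs R n \<Longrightarrow>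
    vec_mult R n c x y \<in> vecs R n"
  unfolding vec_mult_def by (intro lincomb_closed) auto

lemma lincomb_cong:
  assumes "\<And>i. i < n \<Longrightarrow> M i = M' i" "\<And>i. i < n \<Longrightarrow> M i \<in> vecs R n" "x \<in> vecs R n"
  shows "lincomb R n M x = lincomb R n M' x"
  unfolding lincomb_def
  using assms by (intro restrict_ext finsum_cong') auto

lemma vec_add_nth [simp]: "k < n \<Longrightarrow> vec_add R n x y k = x k \<oplus> y k"
  by (simp add: vec_add_def)

lemma smult_vec_nth [simp]: "k < n \<Longrightarrow> smult_vec R n x a k = a \<otimes> x k"
  by (simp add: smult_vec_def)

lemma lincomb_add:
  assumes M: "\<And>i. i < n \<Longrightarrow> M i \<in> vecs R n" and x: "x \<in> vecs R n" and y: "y \<in> vecs R n"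
  shows "lincomb R n M (vec_add R n x y) = vec_add R n (lincomb R n M x) (lincomb R n M y)"
proof (rule vecs_eqI[of _ R n])
  fix k assume k: "k < n"
  have [simp]: "M i k \<in> carrier R" "x i \<in> carrier R" "y i \<in> carrier R" if "i < n" for i
    using that M x y k by blast+
  have "(\<Oplus>i\<in>{..<n}. vec_add R n x y i \<otimes> M i k) = (\<Oplus>i\<in>{..<n}. x i \<otimes> M i k \<oplus> y i \<otimes> M i k)"
    using M x y k by (intro finsum_cong') (auto simp: l_distr)
  also have "\<dots> = (\<Oplus>i\<in>{..<n}. x i \<otimes> M i k) \<oplus> (\<Oplus>i\<in>{..<n}. y i \<otimes> M i k)"
    using M x y k by (intro finsum_addf) auto
  finally show "lincomb R n M (vec_add R n x y) k = vec_add R n (lincomb R n M x) (lincomb R n M y) k"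
    using k by (simp add: lincomb_def)
qed (use assms in auto)

lemma lincomb_smult:
  assumes M: "\<And>i. i < n \<Longrightarrow> M i \<in> vecs R n" and x: "x \<in> vecs R n" and a: "a \<in> carrier R"
  shows "lincomb R n M (smult_vec R n x a) = smult_vec R n (lincomb R n M x) a"
proof (rule vecs_eqI[of _ R n])
  fix k assume k: "k < n"
  have [simp]: "M i k \<in> carrier R" "x i \<in> carrier R" if "i < n" for i
    using that M x k by blast+
  have "(\<Oplus>i\<in>{..<n}. smult_vec R n x a i \<otimes> M i k) = (\<Oplus>i\<in>{..<n}. a \<otimes> (x i \<otimes> M i k))"
    using M x a k by (intro finsum_cong') (auto simp: m_assoc)
  also have "\<dots> = a \<otimes> (\<Oplus>i\<in>{..<n}. x i \<otimes> M i k)"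
    using M x a k by (intro finsum_rdistr[symmetric]) auto
  finally show "lincomb R n M (smult_vec R n x a) k = smult_vec R n (lincomb R n M x) a k"
    using k by (simp add: lincomb_def)
qed (use assms in auto)

lemma lincomb_unit_vecs:
  assumes x: "x \<in> vecs R n"
  shows "lincomb R n (unit_vec R n) x = x"
proof (rule vecs_eqI[of _ R n])
  fix k assume k: "k < n"
  have [simp]: "x i \<in> carrier R" if "i < n" for i
    using that x by blast
  have "(\<Oplus>i\<in>{..<n}. x i \<otimes> unit_vec R n i k) = (\<Oplus>i\<in>{..<n}. if i = k then x i else \<zero>)"
    using x k by (intro finsum_cong') (auto simp: unit_vec_def)
  also have "\<dots> = x k" using x k by (intro add.finprod_singleton_swap) auto
  finally show "lincomb R n (unit_vec R n) x k = x k" using k by (simp add: lincomb_def)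
qed (use assms in auto)

end

text \<open>Passes from \<open>combine\<close>, in which spans and independence are phrased, to
  indexed sums.\<close>

lemma (in ring) combine_map_upt:
  assumes "\<And>i. i < n \<Longrightarrow> a i \<in> carrier R" "\<And>i. i < n \<Longrightarrow> b i \<in> carrier R"
  shows "combine (map a [0..<n]) (map b [0..<n]) = (\<Oplus>i\<in>{..<n}. a i \<otimes> b i)"
  using assms
proof (induction n)
  case 0
  then show ?case by simp
next
  case (Suc n)
  have "combine (map a [0..<Suc n]) (map b [0..<Suc n]) =
      combine (map a [0..<n]) (map b [0..<n]) \<oplus> combine [a n] [b n]"
    using Suc.prems by (simp add: combine_append[symmetric] image_subset_iff)
  also have "\<dots> = (\<Oplus>i\<in>{..<n}. a i \<otimes> b i) \<oplus> a n \<otimes> b n"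
    using Suc by simp
  also have "\<dots> = (\<Oplus>i\<in>{..<Suc n}. a i \<otimes> b i)"
    using Suc.prems by (simp add: lessThan_Suc Pi_def a_comm)
  finally show ?case .
qed

section \<open>A coordinate algebra that is a field, as an extension of degree n\<close>

locale coord_field = field F for F :: "'a ring" (structure) +
  fixes n :: nat and c :: "nat \<Rightarrow> nat \<Rightarrow> nat \<Rightarrow> 'a" and u :: "nat \<Rightarrow> 'a"
  assumes c_closed: "\<And>i j. i < n \<Longrightarrow> j < n \<Longrightarrow> c i j \<in> vecs F n"
    and alg_field: "field (coord_algebra F n c u)"
begin

abbreviation "A \<equiv> coord_algebra F n c u"
abbreviation "V \<equiv> vecs F n"

sublocale A: field A by (rule alg_field)

lemma u_closed [simp]: "u \<in> V"
  using A.one_closed by simp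

lemma u_nth [simp]: "k < n \<Longrightarrow> u k \<in> carrier F"
  using u_closed by blast

text \<open>The product is linear in its first factor and \<open>u\<close> is the unit, so (a u) x =
  a (u x) = a x.\<close>

lemma scalar_mult:
  assumes "a \<in> carrier F" "x \<in> V"
  shows "smult_vec F n u a \<otimes>\<^bsub>A\<^esub> x = smult_vec F n x a"
proof -
  have "smult_vec F n u a \<otimes>\<^bsub>A\<^esub> x = smult_vec F n (u \<otimes>\<^bsub>A\<^esub> x) a"
    using assms c_closed by (simp add: vec_mult_def lincomb_smult)
  then show ?thesis using A.l_one[of x] assms by simp
qed

lemma scalar_hom: "smult_vec F n u \<in> ring_hom F A"
proof (rule ring_hom_memI)
  fix a b assume ab: "a \<in> carrier F" "b \<in> carrier F"
  show "smult_vec F n u a \<in> carrier A" using ab by simp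
  show "smult_vec F n u (a \<otimes> b) = smult_vec F n u a \<otimes>\<^bsub>A\<^esub> smult_vec F n u b"
    using ab by (subst scalar_mult) (auto intro!: vecs_eqI[of _ F n] simp: m_assoc)
  show "smult_vec F n u (a \<oplus> b) = smult_vec F n u a \<oplus>\<^bsub>A\<^esub> smult_vec F n u b"
    using ab by (auto intro!: vecs_eqI[of _ F n] simp: l_distr)
next
  show "smult_vec F n u \<one> = \<one>\<^bsub>A\<^esub>"
    by (auto intro!: vecs_eqI[of _ F n])
qed

lemma field_ext_coord_algebra: "field_ext F A (smult_vec F n u)"
  unfolding field_ext_def using field_axioms A.field_axioms scalar_hom by blast

lemma finsum_coord_algebra:
  assumes "finite I" "\<And>i. i \<in> I \<Longrightarrow> v i \<in> V" "k < n"
  shows "finsum A v I k = (\<Oplus>i\<in>I. v i k)"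
  using assms
proof (induction I rule: finite_induct)
  case empty
  then show ?case by simp
next
  case (insert i I)
  then have "finsum A v (insert i I) = vec_add F n (v i) (finsum A v I)"
    by (subst A.finsum_insert) auto
  moreover have "v j k \<in> carrier F" if "j = i \<or> j \<in> I" for j using insert.prems that by blast
  ultimately show ?case using insert by (simp add: Pi_def)
qed

text \<open>Rewrites a coordinate expression as a linear combination inside the field
  \<open>A\<close>, to which general facts about bases and homomorphisms apply.\<close>

lemma lincomb_eq_finsum:
  assumes M: "\<And>i. i < n \<Longrightarrow> M i \<in> V" and x: "x \<in> V"
  shows "lincomb F n M x = (\<Oplus>\<^bsub>A\<^esub>i\<in>{..<n}. smult_vec F n u (x i) \<otimes>\<^bsub>A\<^esub> M i)"
proof (rule vecs_eqI[of _ F n])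
  fix k assume k: "k < n"
  have eq: "(\<Oplus>\<^bsub>A\<^esub>i\<in>{..<n}. smult_vec F n u (x i) \<otimes>\<^bsub>A\<^esub> M i) =
      (\<Oplus>\<^bsub>A\<^esub>i\<in>{..<n}. smult_vec F n (M i) (x i))"
    using M x by (intro A.finsum_cong') (auto simp: scalar_mult[OF vecs_nth] simp del: coord_algebra_simps(2))
  show "lincomb F n M x k = (\<Oplus>\<^bsub>A\<^esub>i\<in>{..<n}. smult_vec F n u (x i) \<otimes>\<^bsub>A\<^esub> M i) k"
  proof -
    have *: "smult_vec F n (M i) (x i) \<in> V" if "i < n" for i using M x that by blast
    have "(\<Oplus>\<^bsub>A\<^esub>i\<in>{..<n}. smult_vec F n (M i) (x i)) k = (\<Oplus>i\<in>{..<n}. smult_vec F n (M i) (x i) k)"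
      by (rule finsum_coord_algebra) (use * k in auto)
    then show ?thesis using eq k by (simp add: lincomb_def)
  qed
next
  have "(\<Oplus>\<^bsub>A\<^esub>i\<in>{..<n}. smult_vec F n u (x i) \<otimes>\<^bsub>A\<^esub> M i) \<in> carrier A"
    by (rule A.finsum_closed, rule Pi_I, rule A.m_closed) (use M x in auto)
  then show "(\<Oplus>\<^bsub>A\<^esub>i\<in>{..<n}. smult_vec F n u (x i) \<otimes>\<^bsub>A\<^esub> M i) \<in> V" by simp
qed (use assms in auto)

lemma scalars_subfield: "subfield (smult_vec F n u ` carrier F) A"
proof -
  interpret h: ring_hom_ring F A "smult_vec F n u"
    by (rule ring_hom_ringI2[OF ring_axioms A.ring_axioms scalar_hom])
  show ?thesis
    using h.img_is_subfield(2)[OF carrier_is_subfield] A.one_not_zero by simp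
qed

text \<open>The unit vectors form a basis: combining them with the coefficients of \<open>x\<close>
  returns \<open>x\<close>, which gives both spanning and independence.\<close>

lemma ext_degree_coord_algebra: "ext_degree F A (smult_vec F n u) n"
proof -
  let ?K = "smult_vec F n u ` carrier F" and ?Us = "map (unit_vec F n) [0..<n]"
  have comb: "A.combine (map (\<lambda>i. smult_vec F n u (x i)) [0..<n]) ?Us = x" if "x \<in> V" for x
    using that
    by (subst A.combine_map_upt) (auto simp: lincomb_eq_finsum[symmetric] lincomb_unit_vecs simp del: coord_algebra_simps(2))
  have Us: "set ?Us \<subseteq> carrier A" by auto
  have coord: "\<exists>x \<in> V. Ks = map (\<lambda>i. smult_vec F n u (x i)) [0..<n]"
    if "set Ks \<subseteq> ?K" "length Ks = n" for Ks
  proof -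
    have "\<exists>ks. Ks = map (smult_vec F n u) ks \<and> set ks \<subseteq> carrier F"
      using that(1)
    proof (induction Ks)
      case (Cons k Ks)
      then obtain ks a where "Ks = map (smult_vec F n u) ks" "set ks \<subseteq> carrier F"
        "k = smult_vec F n u a" "a \<in> carrier F" by auto
      then show ?case by (intro exI[of _ "a # ks"]) auto
    qed simp
    then obtain ks where ks: "Ks = map (smult_vec F n u) ks" "set ks \<subseteq> carrier F" by blast
    show ?thesis
      using ks that(2)
      by (intro bexI[of _ "\<lambda>i \<in> {..<n}. ks ! i"] vecsI) (auto intro!: nth_equalityI simp: subset_iff)
  qed
  have len: "length ?Us = n" by simp
  have "A.independent ?K ?Us"
  proof (rule ccontr)
    assume "\<not> A.independent ?K ?Us"
    then obtain Ks where Ks: "length Ks = length ?Us" "A.combine Ks ?Us = \<zero>\<^bsub>A\<^esub>"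
        "set Ks \<subseteq> ?K" "set Ks \<noteq> {\<zero>\<^bsub>A\<^esub>}"
      by (rule A.dependent_imp_non_trivial_combine[OF scalars_subfield Us])
    then obtain x where x: "x \<in> V" "Ks = map (\<lambda>i. smult_vec F n u (x i)) [0..<n]"
      using coord[of Ks] by auto
    have "x = \<zero>\<^bsub>A\<^esub>" using comb[OF x(1)] Ks(2) unfolding x(2) by simp
    moreover have "smult_vec F n u \<zero> = \<zero>\<^bsub>A\<^esub>"
      by (auto intro!: vecs_eqI[of _ F n])
    moreover have "n \<noteq> 0"
    proof
      assume "n = 0"
      then have "\<one>\<^bsub>A\<^esub> = \<zero>\<^bsub>A\<^esub>"
        using vecs_eqI[of "\<one>\<^bsub>A\<^esub>" F n "\<zero>\<^bsub>A\<^esub>"] A.one_closed A.zero_closed by simp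
      then show False using A.one_not_zero by blast
    qed
    ultimately have "set Ks = {\<zero>\<^bsub>A\<^esub>}" unfolding x(2) by auto
    then show False using Ks(4) by blast
  qed
  moreover have "A.Span ?K ?Us = carrier A"
  proof
    show "A.Span ?K ?Us \<subseteq> carrier A"
      using A.Span_subgroup_props(1)[OF scalars_subfield Us] .
    show "carrier A \<subseteq> A.Span ?K ?Us"
    proof
      fix x assume "x \<in> carrier A"
      then have x: "x \<in> V" by simp
      show "x \<in> A.Span ?K ?Us"
        unfolding A.Span_mem_iff_length_version[OF scalars_subfield Us]
        using comb[OF x] vecs_nth[OF x]
        by (intro exI[of _ "map (\<lambda>i. smult_vec F n u (x i)) [0..<n]"]) auto
    qed
  qed
  ultimately show ?thesis
    unfolding ext_degree_def using A.dimensionI[OF scalars_subfield] len by metis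
qed

lemma is_ext_with_Aut_coord_algebra_iff:
  "is_ext_with_Aut F A (smult_vec F n u) n H \<longleftrightarrow> Aut_ext F A (smult_vec F n u) \<cong> H"
  by (simp add: is_ext_with_Aut_def field_ext_coord_algebra ext_degree_coord_algebra)

end

lemma (in abelian_monoid) finsum_swap:
  assumes "finite I" "finite J" "\<And>i j. i \<in> I \<Longrightarrow> j \<in> J \<Longrightarrow> f i j \<in> carrier G"
  shows "(\<Oplus>i\<in>I. \<Oplus>j\<in>J. f i j) = (\<Oplus>j\<in>J. \<Oplus>i\<in>I. f i j)"
  using assms(1,3)
proof (induction I rule: finite_induct)
  case empty
  then show ?case by (simp add: finsum_zero)
next
  case (insert i I)
  have "(\<Oplus>i\<in>insert i I. \<Oplus>j\<in>J. f i j) = (\<Oplus>j\<in>J. f i j) \<oplus> (\<Oplus>j\<in>J. \<Oplus>i\<in>I. f i j)"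
    using insert by (simp add: Pi_def)
  also have "\<dots> = (\<Oplus>j\<in>J. f i j \<oplus> (\<Oplus>i\<in>I. f i j))"
    using insert by (intro finsum_addf[symmetric]) auto
  also have "\<dots> = (\<Oplus>j\<in>J. \<Oplus>i\<in>insert i I. f i j)"
    using insert by (intro finsum_cong') (auto simp: Pi_def)
  finally show ?case .
qed

section \<open>Coordinates on a finite extension\<close>

theorem ext_iso_coord_algebra:
  fixes F :: "'a ring" and L :: "'b ring"
  assumes ext: "is_ext_with_Aut F L h n H"
  obtains c u where "\<And>i j. c i j \<in> vecs F n" "u \<in> vecs F n"
    "field (coord_algebra F n c u)" "Aut_ext F (coord_algebra F n c u) (smult_vec F n u) \<cong> H"
proof -
  interpret F: field F using ext by (simp add: is_ext_with_Aut_def field_ext_def)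
  interpret L: field L using ext by (simp add: is_ext_with_Aut_def field_ext_def)
  have hh: "h \<in> ring_hom F L" using ext by (simp add: is_ext_with_Aut_def field_ext_def)
  interpret hr: ring_hom_ring F L h
    by (rule ring_hom_ringI2[OF F.ring_axioms L.ring_axioms hh])
  interpret h: ring_hom_cring F L h
    by (rule ring_hom_cringI[OF F.is_cring L.is_cring hh])
  let ?K = "h ` carrier F"
  have K: "subfield ?K L"
    using hr.img_is_subfield(2)[OF F.carrier_is_subfield] L.one_not_zero by simp
  have h_inj: "inj_on h (carrier F)"
    by (rule non_trivial_field_hom_is_inj[OF hh F.field_axioms L.field_axioms])
  have dim: "L.dimension n ?K (carrier L)"
    using ext by (simp add: is_ext_with_Aut_def ext_degree_def)
  obtain Us where Us: "set Us \<subseteq> carrier L" "L.independent ?K Us" "length Us = n"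
      "L.Span ?K Us = carrier L"
    using L.exists_base[OF K dim] by blast
  define w where "w i = Us ! i" for i
  have w [simp]: "w i \<in> carrier L" if "i < n" for i using Us(1,3) that by (auto simp: w_def)
  have Us_w: "Us = map w [0..<n]" using Us(3) by (auto simp: w_def intro: nth_equalityI)
  define \<kappa> where "\<kappa> x = (\<Oplus>\<^bsub>L\<^esub>i\<in>{..<n}. h (x i) \<otimes>\<^bsub>L\<^esub> w i)" for x
  have \<kappa>_combine: "\<kappa> x = L.combine (map (\<lambda>i. h (x i)) [0..<n]) Us" if "x \<in> vecs F n" for x
    unfolding \<kappa>_def Us_w using vecs_nth[OF that] by (intro L.combine_map_upt[symmetric]) auto
  have \<kappa>_closed [simp]: "\<kappa> x \<in> carrier L" if "x \<in> vecs F n" for x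
    unfolding \<kappa>_def using vecs_nth[OF that] by (intro L.finsum_closed) auto
  have \<kappa>_inj: "inj_on \<kappa> (vecs F n)"
  proof (rule inj_onI)
    fix x y assume x: "x \<in> vecs F n" and y: "y \<in> vecs F n" and eq: "\<kappa> x = \<kappa> y"
    have "\<kappa> x \<in> L.Span ?K Us" using Us(4) x by simp
    \<comment> \<open>Coefficients over \<open>?K\<close> are unique, and injectivity of
      \<open>h\<close> turns this into uniqueness over F.\<close>
    from L.unique_decomposition[OF K Us(2) this]
    moreover have "set (map (\<lambda>i. h (z i)) [0..<n]) \<subseteq> ?K" if "z \<in> vecs F n" for z
      using vecs_nth[OF that] by auto
    moreover have "length (map (\<lambda>i. h (z i)) [0..<n]) = length Us" for z using Us(3) by simp
    ultimately have "map (\<lambda>i. h (x i)) [0..<n] = map (\<lambda>i. h (y i)) [0..<n]"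
      using \<kappa>_combine[OF x] \<kappa>_combine[OF y] eq x y by metis
    then have "h (x i) = h (y i)" if "i < n" for i using that by simp
    then have "x i = y i" if "i < n" for i
      using that inj_onD[OF h_inj] vecs_nth[OF x] vecs_nth[OF y] by blast
    then show "x = y" using vecs_eqI[OF x y] by blast
  qed
  have \<kappa>_surj: "\<exists>x \<in> vecs F n. \<kappa> x = a" if "a \<in> carrier L" for a
  proof -
    have "a \<in> L.Span ?K Us" using that Us(4) by simp
    then obtain Ks where Ks: "set Ks \<subseteq> ?K" "length Ks = n" "a = L.combine Ks Us"
      unfolding L.Span_mem_iff_length_version[OF K Us(1)] Us(3) by metis
    have "\<forall>i<n. \<exists>b \<in> carrier F. Ks ! i = h b" using Ks(1,2) nth_mem by (metis imageE subsetD)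
    then obtain b where b: "\<And>i. i < n \<Longrightarrow> b i \<in> carrier F \<and> Ks ! i = h (b i)" by metis
    then have x: "(\<lambda>i \<in> {..<n}. b i) \<in> vecs F n" by (intro vecsI) auto
    have "Ks = map (\<lambda>i. h ((\<lambda>i \<in> {..<n}. b i) i)) [0..<n]"
      using Ks(2) b by (intro nth_equalityI) auto
    then show ?thesis using \<kappa>_combine[OF x] Ks(3) x by auto
  qed
  have \<kappa>_bij: "bij_betw \<kappa> (vecs F n) (carrier L)"
    unfolding bij_betw_def
  proof (intro conjI equalityI subsetI)
    fix a assume "a \<in> carrier L"
    then show "a \<in> \<kappa> ` vecs F n" using \<kappa>_surj[of a] by force
  qed (use \<kappa>_inj in auto)
  define g where "g = inv_into (vecs F n) \<kappa>"
  have g_bij: "bij_betw g (carrier L) (vecs F n)"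
    unfolding g_def by (rule bij_betw_inv_into[OF \<kappa>_bij])
  have g_closed [simp]: "g a \<in> vecs F n" if "a \<in> carrier L" for a
    using g_bij that by (auto simp: bij_betw_def)
  have \<kappa>_g [simp]: "\<kappa> (g a) = a" if "a \<in> carrier L" for a
    using bij_betw_inv_into_right[OF \<kappa>_bij that] by (simp add: g_def)
  have g_eqI: "g a = x" if "x \<in> vecs F n" "\<kappa> x = a" for x a
    unfolding g_def that(2)[symmetric] by (rule inv_into_f_f[OF \<kappa>_inj that(1)])
  have \<kappa>_add: "\<kappa> (vec_add F n x y) = \<kappa> x \<oplus>\<^bsub>L\<^esub> \<kappa> y" if x: "x \<in> vecs F n" and y: "y \<in> vecs F n" for x y
  proof -
    have [simp]: "x i \<in> carrier F" "y i \<in> carrier F" if "i < n" for i using that x y by blast+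
    have "\<kappa> (vec_add F n x y) =
        (\<Oplus>\<^bsub>L\<^esub>i\<in>{..<n}. h (x i) \<otimes>\<^bsub>L\<^esub> w i \<oplus>\<^bsub>L\<^esub> h (y i) \<otimes>\<^bsub>L\<^esub> w i)"
      unfolding \<kappa>_def by (intro L.finsum_cong') (auto simp: L.l_distr)
    also have "\<dots> = \<kappa> x \<oplus>\<^bsub>L\<^esub> \<kappa> y"
      unfolding \<kappa>_def by (intro L.finsum_addf) auto
    finally show ?thesis .
  qed
  have \<kappa>_smult: "\<kappa> (smult_vec F n x a) = h a \<otimes>\<^bsub>L\<^esub> \<kappa> x" if x: "x \<in> vecs F n" and a: "a \<in> carrier F" for x a
  proof -
    have [simp]: "x i \<in> carrier F" if "i < n" for i using that x by blast
    have "\<kappa> (smult_vec F n x a) = (\<Oplus>\<^bsub>L\<^esub>i\<in>{..<n}. h a \<otimes>\<^bsub>L\<^esub> (h (x i) \<otimes>\<^bsub>L\<^esub> w i))"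
      unfolding \<kappa>_def using a by (intro L.finsum_cong') (auto simp: L.m_assoc)
    also have "\<dots> = h a \<otimes>\<^bsub>L\<^esub> \<kappa> x"
      unfolding \<kappa>_def using a by (intro L.finsum_rdistr[symmetric]) auto
    finally show ?thesis .
  qed
  have \<kappa>_lincomb: "\<kappa> (lincomb F n M x) = (\<Oplus>\<^bsub>L\<^esub>i\<in>{..<n}. h (x i) \<otimes>\<^bsub>L\<^esub> \<kappa> (M i))"
    if M: "\<And>i. i < n \<Longrightarrow> M i \<in> vecs F n" and x: "x \<in> vecs F n" for M x
  proof -
    have [simp]: "x i \<in> carrier F" if "i < n" for i using that x by blast
    have [simp]: "M i k \<in> carrier F" if "i < n" "k < n" for i k using M[of i] that by blast
    have "\<kappa> (lincomb F n M x) =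
        (\<Oplus>\<^bsub>L\<^esub>k\<in>{..<n}. \<Oplus>\<^bsub>L\<^esub>i\<in>{..<n}. h (x i) \<otimes>\<^bsub>L\<^esub> (h (M i k) \<otimes>\<^bsub>L\<^esub> w k))"
      unfolding \<kappa>_def
    proof (rule L.finsum_cong')
      fix k assume "k \<in> {..<n}"
      then have k: "k < n" by simp
      have "h (lincomb F n M x k) = (\<Oplus>\<^bsub>L\<^esub>i\<in>{..<n}. h (x i) \<otimes>\<^bsub>L\<^esub> h (M i k))"
        using k by (simp add: lincomb_def Pi_def) (rule L.finsum_cong', auto)
      then have "h (lincomb F n M x k) \<otimes>\<^bsub>L\<^esub> w k = (\<Oplus>\<^bsub>L\<^esub>i\<in>{..<n}. h (x i) \<otimes>\<^bsub>L\<^esub> h (M i k) \<otimes>\<^bsub>L\<^esub> w k)"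
        using k by (simp add: L.finsum_ldistr Pi_def)
      also have "\<dots> = (\<Oplus>\<^bsub>L\<^esub>i\<in>{..<n}. h (x i) \<otimes>\<^bsub>L\<^esub> (h (M i k) \<otimes>\<^bsub>L\<^esub> w k))"
        using k by (intro L.finsum_cong') (auto simp: L.m_assoc)
      finally show "h (lincomb F n M x k) \<otimes>\<^bsub>L\<^esub> w k = (\<Oplus>\<^bsub>L\<^esub>i\<in>{..<n}. h (x i) \<otimes>\<^bsub>L\<^esub> (h (M i k) \<otimes>\<^bsub>L\<^esub> w k))" .
    qed (auto intro!: L.finsum_closed)
    \<comment> \<open>Exchanging the sums collects the coordinates of each row into
      \<open>\<kappa> (M i)\<close>.\<close>
    also have "\<dots> = (\<Oplus>\<^bsub>L\<^esub>i\<in>{..<n}. \<Oplus>\<^bsub>L\<^esub>k\<in>{..<n}. h (x i) \<otimes>\<^bsub>L\<^esub> (h (M i k) \<otimes>\<^bsub>L\<^esub> w k))"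
      by (rule L.finsum_swap) auto
    also have "\<dots> = (\<Oplus>\<^bsub>L\<^esub>i\<in>{..<n}. h (x i) \<otimes>\<^bsub>L\<^esub> \<kappa> (M i))"
      unfolding \<kappa>_def
      by (intro L.finsum_cong' refl L.finsum_rdistr[symmetric]) (auto intro!: L.m_closed L.finsum_closed)
    finally show ?thesis .
  qed
  \<comment> \<open>Outside the range the value is an arbitrary vector, since \<open>c i j\<close>
    has to be a vector for all indices.\<close>
  define c where "c i j = (if i < n \<and> j < n then g (w i \<otimes>\<^bsub>L\<^esub> w j) else g \<one>\<^bsub>L\<^esub>)" for i j
  define u where "u = g \<one>\<^bsub>L\<^esub>"
  have c: "c i j \<in> vecs F n" for i j by (simp add: c_def)
  have u: "u \<in> vecs F n" by (simp add: u_def)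
  \<comment> \<open>Under \<kappa>, multiplication by \<open>w i\<close> has the matrix
    \<open>c i\<close>; the full product formula then follows by linearity in the other
    factor.\<close>
  have \<kappa>_row: "\<kappa> (lincomb F n (c i) y) = w i \<otimes>\<^bsub>L\<^esub> \<kappa> y" if i: "i < n" and y: "y \<in> vecs F n" for i y
  proof -
    have [simp]: "y j \<in> carrier F" if "j < n" for j using that y by blast
    have "\<kappa> (lincomb F n (c i) y) = (\<Oplus>\<^bsub>L\<^esub>j\<in>{..<n}. h (y j) \<otimes>\<^bsub>L\<^esub> \<kappa> (c i j))"
      using c y by (intro \<kappa>_lincomb) auto
    also have "\<dots> = (\<Oplus>\<^bsub>L\<^esub>j\<in>{..<n}. w i \<otimes>\<^bsub>L\<^esub> (h (y j) \<otimes>\<^bsub>L\<^esub> w j))"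
      using i by (intro L.finsum_cong') (auto simp: c_def L.m_lcomm)
    also have "\<dots> = w i \<otimes>\<^bsub>L\<^esub> \<kappa> y"
      unfolding \<kappa>_def using i by (intro L.finsum_rdistr[symmetric]) auto
    finally show ?thesis .
  qed
  have \<kappa>_mult: "\<kappa> (vec_mult F n c x y) = \<kappa> x \<otimes>\<^bsub>L\<^esub> \<kappa> y" if x: "x \<in> vecs F n" and y: "y \<in> vecs F n" for x y
  proof -
    have [simp]: "x j \<in> carrier F" if "j < n" for j using that x by blast
    have "\<kappa> (vec_mult F n c x y) = (\<Oplus>\<^bsub>L\<^esub>i\<in>{..<n}. h (x i) \<otimes>\<^bsub>L\<^esub> \<kappa> (lincomb F n (c i) y))"
      unfolding vec_mult_def using c x y by (intro \<kappa>_lincomb) auto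
    also have "\<dots> = (\<Oplus>\<^bsub>L\<^esub>i\<in>{..<n}. h (x i) \<otimes>\<^bsub>L\<^esub> w i \<otimes>\<^bsub>L\<^esub> \<kappa> y)"
      using y by (intro L.finsum_cong') (auto simp: \<kappa>_row L.m_assoc)
    also have "\<dots> = \<kappa> x \<otimes>\<^bsub>L\<^esub> \<kappa> y"
      unfolding \<kappa>_def[of x] using y by (intro L.finsum_ldistr[symmetric]) auto
    finally show ?thesis .
  qed
  let ?A = "coord_algebra F n c u"
  have g_iso: "g \<in> ring_iso L ?A"
  proof (rule ring_iso_memI)
    show "bij_betw g (carrier L) (carrier ?A)" using g_bij by simp
    show "g \<one>\<^bsub>L\<^esub> = \<one>\<^bsub>?A\<^esub>" by (simp add: u_def)
    fix a b assume "a \<in> carrier L" "b \<in> carrier L"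
    then show "g (a \<otimes>\<^bsub>L\<^esub> b) = g a \<otimes>\<^bsub>?A\<^esub> g b" "g (a \<oplus>\<^bsub>L\<^esub> b) = g a \<oplus>\<^bsub>?A\<^esub> g b"
      using c by (auto intro!: g_eqI simp: \<kappa>_mult \<kappa>_add F.vec_mult_closed F.vec_add_closed)
  qed simp
  \<comment> \<open>\<open>ring_iso\<close> does not speak of zero, so the zero of the algebra is
    identified by hand before the field property is transferred.\<close>
  have "g \<zero>\<^bsub>L\<^esub> = \<zero>\<^bsub>?A\<^esub>"
  proof -
    have "\<kappa> (\<lambda>k \<in> {..<n}. \<zero>\<^bsub>F\<^esub>) = \<zero>\<^bsub>L\<^esub>"
      unfolding \<kappa>_def by (rule L.add.finprod_one_eqI) auto
    then show ?thesis by (auto intro!: g_eqI)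
  qed
  then have A: "field ?A" using L.ring_iso_imp_img_field[OF g_iso] by (simp add: coord_algebra_def)
  interpret A: field ?A by (rule A)
  have gh: "(g \<circ> h) a = smult_vec F n u a" if "a \<in> carrier F" for a
    using that u by (auto intro!: g_eqI simp: \<kappa>_smult u_def F.smult_vec_closed)
  have "Aut_ext F ?A (g \<circ> h) \<cong> Aut_ext F L h"
    by (rule Aut_ext_image_iso[OF L.ring_axioms A.ring_axioms g_iso]) auto
  then have "Aut_ext F ?A (g \<circ> h) \<cong> H"
    using ext iso_trans unfolding is_ext_with_Aut_def by blast
  \<comment> \<open>The two embeddings agree only on the carrier of F; \<open>Aut_ext\<close>
    depends on nothing but the image.\<close>
  moreover have "(g \<circ> h) ` carrier F = smult_vec F n u ` carrier F"
    using gh by (rule image_cong[OF refl])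
  ultimately have "Aut_ext F ?A (smult_vec F n u) \<cong> H" unfolding Aut_ext_def by (simp only:)
  then show thesis using that[OF c u A] by blast
qed

section \<open>Automorphisms as matrices\<close>

text \<open>Additivity is built into \<open>lincomb\<close>, fixing \<open>u\<close> means fixing F,
  and surjectivity stands for bijectivity because homomorphisms between fields are
  injective.\<close>

definition aut_matrix :: "('a, 'k) ring_scheme \<Rightarrow> nat \<Rightarrow> (nat \<Rightarrow> nat \<Rightarrow> nat \<Rightarrow> 'a) \<Rightarrow> (nat \<Rightarrow> 'a) \<Rightarrow>
    (nat \<Rightarrow> nat \<Rightarrow> 'a) \<Rightarrow> bool" where
  "aut_matrix F n c u M \<longleftrightarrow>
     lincomb F n M u = u \<and>
     (\<forall>x \<in> vecs F n. \<forall>y \<in> vecs F n.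
        lincomb F n M (vec_mult F n c x y) = vec_mult F n c (lincomb F n M x) (lincomb F n M y)) \<and>
     (\<forall>y \<in> vecs F n. \<exists>x \<in> vecs F n. lincomb F n M x = y)"

text \<open>Matrices are compared through their action, as only the first n rows of \<open>M\<close>
  and \<open>B h\<close> affect it.\<close>

definition aut_matrices :: "('a, 'k) ring_scheme \<Rightarrow> nat \<Rightarrow> (nat \<Rightarrow> nat \<Rightarrow> nat \<Rightarrow> 'a) \<Rightarrow> (nat \<Rightarrow> 'a) \<Rightarrow>
    nat \<Rightarrow> (nat \<Rightarrow> nat \<Rightarrow> nat) \<Rightarrow> (nat \<Rightarrow> nat \<Rightarrow> nat \<Rightarrow> 'a) \<Rightarrow> bool" where
  "aut_matrices F n c u m T B \<longleftrightarrow>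
     (\<forall>h<m. aut_matrix F n c u (B h)) \<and>
     (\<forall>h<m. \<forall>k<m. h \<noteq> k \<longrightarrow> (\<exists>x \<in> vecs F n. lincomb F n (B h) x \<noteq> lincomb F n (B k) x)) \<and>
     (\<forall>h<m. \<forall>k<m. \<forall>x \<in> vecs F n.
        lincomb F n (B h) (lincomb F n (B k) x) = lincomb F n (B (T h k)) x) \<and>
     (\<forall>M. (\<forall>i. M i \<in> vecs F n) \<and> aut_matrix F n c u M \<longrightarrow>
        (\<exists>h<m. \<forall>x \<in> vecs F n. lincomb F n M x = lincomb F n (B h) x))"

context coord_field
begin

abbreviation "Aut \<equiv> Aut_ext F A (smult_vec F n u)"

lemma mem_Aut_iff:
  "s \<in> carrier Aut \<longleftrightarrow> s \<in> Bij V \<and> s \<in> ring_hom A A \<and> (\<forall>a \<in> carrier F. s (smult_vec F n u a) = smult_vec F n u a)"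
  by (auto simp: Aut_ext_def)

lemma mult_Aut:
  assumes "s \<in> carrier Aut" "t \<in> carrier Aut"
  shows "s \<otimes>\<^bsub>Aut\<^esub> t = (\<lambda>x \<in> V. s (t x))"
  using assms by (simp add: Aut_ext_def BijGroup_def compose_def)

lemma Aut_closed: "s \<in> carrier Aut \<Longrightarrow> x \<in> V \<Longrightarrow> s x \<in> V"
  by (auto simp: mem_Aut_iff Bij_def bij_betw_def)

lemma Aut_mult_closed:
  assumes s: "s \<in> carrier Aut" and t: "t \<in> carrier Aut"
  shows "s \<otimes>\<^bsub>Aut\<^esub> t \<in> carrier Aut"
  unfolding mult_Aut[OF assms] mem_Aut_iff
proof (intro conjI ballI)
  show "(\<lambda>x \<in> V. s (t x)) \<in> Bij V"
    using compose_Bij[of s V t] s t by (simp add: mem_Aut_iff compose_def)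
  have hom: "s \<in> ring_hom A A" "t \<in> ring_hom A A" using s t by (auto simp: mem_Aut_iff)
  show "(\<lambda>x \<in> V. s (t x)) \<in> ring_hom A A"
    using ring_hom_trans[OF hom(2,1)] A.m_closed A.a_closed by (auto simp: ring_hom_def)
  show "(\<lambda>x \<in> V. s (t x)) (smult_vec F n u a) = smult_vec F n u a" if "a \<in> carrier F" for a
    using s t that by (simp add: mem_Aut_iff)
qed

lemma Aut_of_matrix:
  assumes M: "\<And>i. i < n \<Longrightarrow> M i \<in> V" and aut: "aut_matrix F n c u M"
  shows "(\<lambda>x \<in> V. lincomb F n M x) \<in> carrier Aut"
  unfolding mem_Aut_iff
proof (intro conjI ballI)
  let ?s = "\<lambda>x \<in> V. lincomb F n M x"
  show hom: "?s \<in> ring_hom A A"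
    using aut M c_closed by (auto intro!: ring_hom_memI simp: aut_matrix_def lincomb_add)
  have "inj_on ?s V"
    using non_trivial_field_hom_is_inj[OF hom A.field_axioms A.field_axioms] by simp
  moreover have "?s ` V = V"
  proof
    show "?s ` V \<subseteq> V" using M by auto
    show "V \<subseteq> ?s ` V" using aut by (force simp: aut_matrix_def)
  qed
  ultimately show "?s \<in> Bij V" by (simp add: Bij_def bij_betw_def)
  show "?s (smult_vec F n u a) = smult_vec F n u a" if "a \<in> carrier F" for a
    using aut M that by (simp add: lincomb_smult aut_matrix_def)
qed

text \<open>An automorphism that fixes the scalars is F-linear, hence determined by the images of
  the unit vectors.\<close>

lemma Aut_eq_lincomb:
  assumes s: "s \<in> carrier Aut" and x: "x \<in> V"
  shows "s x = lincomb F n (\<lambda>i. s (unit_vec F n i)) x"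
proof -
  have hom: "s \<in> ring_hom A A" and fixF: "\<And>a. a \<in> carrier F \<Longrightarrow> s (smult_vec F n u a) = smult_vec F n u a"
    using s by (auto simp: mem_Aut_iff)
  interpret s: ring_hom_cring A A s
    by (rule ring_hom_cringI[OF A.is_cring A.is_cring hom])
  have closed: "s y \<in> V" if "y \<in> V" for y using s.hom_closed[of y] that by simp
  have "s x = s (\<Oplus>\<^bsub>A\<^esub>i\<in>{..<n}. smult_vec F n u (x i) \<otimes>\<^bsub>A\<^esub> unit_vec F n i)"
    using lincomb_unit_vecs[OF x] lincomb_eq_finsum[of "unit_vec F n", OF _ x] by simp
  also have "\<dots> = (\<Oplus>\<^bsub>A\<^esub>i\<in>{..<n}. (s \<circ> (\<lambda>i. smult_vec F n u (x i) \<otimes>\<^bsub>A\<^esub> unit_vec F n i)) i)"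
    by (rule s.hom_finsum, rule Pi_I, rule A.m_closed) (use vecs_nth[OF x] in auto)
  also have "\<dots> = (\<Oplus>\<^bsub>A\<^esub>i\<in>{..<n}. smult_vec F n u (x i) \<otimes>\<^bsub>A\<^esub> s (unit_vec F n i))"
  proof (rule A.finsum_cong'[OF refl])
    show "(\<lambda>i. smult_vec F n u (x i) \<otimes>\<^bsub>A\<^esub> s (unit_vec F n i)) \<in> {..<n} \<rightarrow> carrier A"
      by (rule Pi_I, rule A.m_closed) (use vecs_nth[OF x] closed in auto)
    show "(s \<circ> (\<lambda>i. smult_vec F n u (x i) \<otimes>\<^bsub>A\<^esub> unit_vec F n i)) i =
        smult_vec F n u (x i) \<otimes>\<^bsub>A\<^esub> s (unit_vec F n i)" if "i \<in> {..<n}" for i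
      unfolding comp_def using vecs_nth[OF x, of i] that fixF
      by (subst s.hom_mult) (auto simp del: coord_algebra_simps(2))
  qed
  also have "\<dots> = lincomb F n (\<lambda>i. s (unit_vec F n i)) x"
    by (rule lincomb_eq_finsum[symmetric]) (use x closed in auto)
  finally show ?thesis .
qed

lemma matrix_of_Aut:
  assumes s: "s \<in> carrier Aut"
  shows "aut_matrix F n c u (\<lambda>i. s (unit_vec F n i))"
proof -
  have hom: "s \<in> ring_hom A A" and bij: "bij_betw s V V"
    using s by (auto simp: mem_Aut_iff Bij_def)
  have "s ` V = V" using bij by (simp add: bij_betw_def)
  then have closed: "s y \<in> V" if "y \<in> V" for y using that by blast
  show ?thesis
    unfolding aut_matrix_def
  proof (intro conjI ballI)
    have "s u = u" using ring_hom_one[OF hom] by simp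
    then show "lincomb F n (\<lambda>i. s (unit_vec F n i)) u = u"
      unfolding Aut_eq_lincomb[OF s u_closed, symmetric] .
    fix y assume y: "y \<in> V"
    then obtain x where x: "x \<in> V" "s x = y" using bij unfolding bij_betw_def by (metis imageE)
    then show "\<exists>x \<in> V. lincomb F n (\<lambda>i. s (unit_vec F n i)) x = y"
      by (intro bexI[OF _ x(1)] trans[OF Aut_eq_lincomb[OF s x(1), symmetric] x(2)])
    fix x assume x: "x \<in> V"
    have "s (vec_mult F n c x y) = vec_mult F n c (s x) (s y)"
      using ring_hom_mult[OF hom, of x y] x y by simp
    moreover have "vec_mult F n c x y \<in> V" using x y c_closed by blast
    ultimately show "lincomb F n (\<lambda>i. s (unit_vec F n i)) (vec_mult F n c x y) =
        vec_mult F n c (lincomb F n (\<lambda>i. s (unit_vec F n i)) x) (lincomb F n (\<lambda>i. s (unit_vec F n i)) y)"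
      using Aut_eq_lincomb[OF s x] Aut_eq_lincomb[OF s y] Aut_eq_lincomb[OF s] by metis
  qed
qed

text \<open>Read \<open>g h |-> B h\<close> as a map from H to the automorphism group: the clauses
  of \<open>aut_matrices\<close> say in turn that it is well defined, injective, multiplicative and
  surjective.\<close>

theorem Aut_iso_iff_aut_matrices:
  assumes H: "group H" and g: "bij_betw g {..<m} (carrier H)"
    and T: "\<And>h k. h < m \<Longrightarrow> k < m \<Longrightarrow> T h k < m \<and> g (T h k) = g h \<otimes>\<^bsub>H\<^esub> g k"
  shows "Aut \<cong> H \<longleftrightarrow> (\<exists>B. (\<forall>h i. B h i \<in> V) \<and> aut_matrices F n c u m T B)"
proof
  interpret H: group H by fact
  have g_inj: "inj_on g {..<m}" and g_im: "g ` {..<m} = carrier H"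
    using g by (auto simp: bij_betw_def)
  {
    assume "\<exists>B. (\<forall>h i. B h i \<in> V) \<and> aut_matrices F n c u m T B"
    then obtain B where BV: "\<And>h i. B h i \<in> V" and B: "aut_matrices F n c u m T B" by blast
    define \<psi> where "\<psi> a = (\<lambda>x \<in> V. lincomb F n (B (inv_into {..<m} g a)) x)" for a
    have \<psi>_g: "\<psi> (g h) = (\<lambda>x \<in> V. lincomb F n (B h) x)" if "h < m" for h
      using that g_inj by (simp add: \<psi>_def)
    have \<psi>_closed: "\<psi> (g h) \<in> carrier Aut" if "h < m" for h
      unfolding \<psi>_g[OF that] using B BV that by (intro Aut_of_matrix) (auto simp: aut_matrices_def)
    have "\<psi> \<in> hom H Aut"
    proof (rule homI)
      fix a assume "a \<in> carrier H"
      then obtain h where "h < m" "a = g h" using g_im by blast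
      then show "\<psi> a \<in> carrier Aut" using \<psi>_closed by simp
      fix b assume "b \<in> carrier H"
      then obtain h k where hk: "h < m" "k < m" "a = g h" "b = g k"
        using \<open>a \<in> carrier H\<close> g_im by (metis imageE lessThan_iff)
      have "\<psi> (a \<otimes>\<^bsub>H\<^esub> b) = \<psi> (g (T h k))" using T hk by simp
      also have "\<dots> = (\<lambda>x \<in> V. lincomb F n (B h) (lincomb F n (B k) x))"
        using B T hk \<psi>_g[of "T h k"] by (auto simp: aut_matrices_def intro!: restrict_ext)
      also have "\<dots> = \<psi> a \<otimes>\<^bsub>Aut\<^esub> \<psi> b"
        using hk \<psi>_closed BV by (auto simp: mult_Aut \<psi>_g intro!: restrict_ext)
      finally show "\<psi> (a \<otimes>\<^bsub>H\<^esub> b) = \<psi> a \<otimes>\<^bsub>Aut\<^esub> \<psi> b" .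
    qed
    moreover have "inj_on \<psi> (carrier H)"
    proof (rule inj_onI)
      fix a b assume "a \<in> carrier H" "b \<in> carrier H" and eq: "\<psi> a = \<psi> b"
      then obtain h k where hk: "h < m" "k < m" "a = g h" "b = g k" using g_im by blast
      have "lincomb F n (B h) x = lincomb F n (B k) x" if "x \<in> V" for x
        using fun_cong[OF eq, of x] hk that by (simp add: \<psi>_g)
      moreover have "\<exists>x \<in> V. lincomb F n (B h) x \<noteq> lincomb F n (B k) x" if "h \<noteq> k"
        using B hk(1,2) that unfolding aut_matrices_def by metis
      ultimately have "h = k" by metis
      then show "a = b" using hk by simp
    qed
    moreover have "\<psi> ` carrier H = carrier Aut"
    proof
      show "\<psi> ` carrier H \<subseteq> carrier Aut"
        unfolding g_im[symmetric] using \<psi>_closed by auto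
      show "carrier Aut \<subseteq> \<psi> ` carrier H"
      proof
        fix s assume s: "s \<in> carrier Aut"
        have sV: "s ` V = V" and ext: "s \<in> extensional V"
          using s by (auto simp: mem_Aut_iff Bij_def bij_betw_def)
        \<comment> \<open>For i beyond n the unit vector is zero, so all rows are vectors, as the
          completeness clause demands.\<close>
        have "\<forall>i. s (unit_vec F n i) \<in> V"
          using imageI[OF unit_vec_closed, of s n] unfolding sV by simp
        then obtain h where h: "h < m" "\<forall>x \<in> V. lincomb F n (\<lambda>i. s (unit_vec F n i)) x = lincomb F n (B h) x"
          using B matrix_of_Aut[OF s] unfolding aut_matrices_def by meson
        have "s = \<psi> (g h)"
          unfolding \<psi>_g[OF h(1)]
        proof (rule extensionalityI[OF ext])
          fix x assume x: "x \<in> V"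
          have "s x = lincomb F n (B h) x"
            unfolding Aut_eq_lincomb[OF s x] using h(2) x by blast
          then show "s x = (\<lambda>x \<in> V. lincomb F n (B h) x) x" using x by simp
        qed simp
        then show "s \<in> \<psi> ` carrier H" using h g_im by blast
      qed
    qed
    \<comment> \<open>The isomorphism starts at H, the side known to be a group, and is then
      inverted.\<close>
    ultimately have "\<psi> \<in> iso H Aut" by (simp add: iso_def bij_betw_def)
    then show "Aut \<cong> H" using H.iso_set_sym by (auto simp: is_iso_def)
  }
  {
    assume "Aut \<cong> H"
    then obtain \<phi> where \<phi>: "\<phi> \<in> hom Aut H" "bij_betw \<phi> (carrier Aut) (carrier H)"
      by (auto simp: is_iso_def iso_def)
    have \<phi>_inj: "inj_on \<phi> (carrier Aut)" and \<phi>_im: "\<phi> ` carrier Aut = carrier H"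
      using \<phi>(2) by (auto simp: bij_betw_def)
    have "\<exists>s. s \<in> carrier Aut \<and> \<phi> s = g h" if "h < m" for h
    proof -
      have "g h \<in> \<phi> ` carrier Aut" using that unfolding \<phi>_im g_im[symmetric] by simp
      then show ?thesis by (auto simp del: coord_algebra_simps)
    qed
    then obtain s where s: "\<And>h. h < m \<Longrightarrow> s h \<in> carrier Aut \<and> \<phi> (s h) = g h" by metis
    define B where "B h i = (if h < m then s h (unit_vec F n i) else u)" for h i
    have B_eq: "B h = (\<lambda>i. s h (unit_vec F n i))" if "h < m" for h
      using that by (simp add: B_def fun_eq_iff)
    have lin: "lincomb F n (B h) x = s h x" if "h < m" "x \<in> V" for h x
      using Aut_eq_lincomb[of "s h" x] s that by (simp add: B_eq)
    have mult: "s h (s k x) = s (T h k) x" if hk: "h < m" "k < m" and x: "x \<in> V" for h k x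
    proof -
      have sh: "s h \<in> carrier Aut" and sk: "s k \<in> carrier Aut" and sT: "s (T h k) \<in> carrier Aut"
        using s T hk by auto
      \<comment> \<open>Injectivity of \<phi> lifts the multiplication table of H to the
        automorphisms.\<close>
      have "\<phi> (s h \<otimes>\<^bsub>Aut\<^esub> s k) = \<phi> (s (T h k))"
        using hom_mult[OF \<phi>(1) sh sk] s T hk by simp
      then have "s h \<otimes>\<^bsub>Aut\<^esub> s k = s (T h k)"
        by (rule inj_onD[OF \<phi>_inj _ Aut_mult_closed[OF sh sk] sT])
      then have "(\<lambda>x \<in> V. s h (s k x)) x = s (T h k) x"
        unfolding mult_Aut[OF sh sk] by (rule fun_cong)
      then show ?thesis using x by simp
    qed
    have "aut_matrices F n c u m T B"
      unfolding aut_matrices_def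
    proof (intro conjI allI impI ballI)
      fix h assume h: "h < m"
      show "aut_matrix F n c u (B h)" using matrix_of_Aut[of "s h"] s h by (simp add: B_eq)
      fix k assume k: "k < m"
      show "\<exists>x \<in> V. lincomb F n (B h) x \<noteq> lincomb F n (B k) x" if "h \<noteq> k"
      proof (rule ccontr)
        assume "\<not> (\<exists>x \<in> V. lincomb F n (B h) x \<noteq> lincomb F n (B k) x)"
        then have "s h x = s k x" if "x \<in> V" for x using lin h k that by auto
        moreover have "s h \<in> extensional V" "s k \<in> extensional V"
          using s h k by (auto simp: mem_Aut_iff Bij_def)
        ultimately have "s h = s k" by (metis extensionalityI)
        then have "g h = g k" using s h k by metis
        then show False using g_inj h k that by (auto dest: inj_onD)
      qed
      show "lincomb F n (B h) (lincomb F n (B k) x) = lincomb F n (B (T h k)) x" if "x \<in> V" for x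
        using h k that s T Aut_closed by (simp add: lin mult)
    next
      fix M assume M: "(\<forall>i. M i \<in> V) \<and> aut_matrix F n c u M"
      define t where "t = (\<lambda>x \<in> V. lincomb F n M x)"
      have t: "t \<in> carrier Aut" unfolding t_def using M by (intro Aut_of_matrix) auto
      then have "\<phi> t \<in> g ` {..<m}" using \<phi>_im g_im by blast
      then obtain h where h: "h < m" "\<phi> t = g h" by auto
      then have "t = s h" using inj_onD[OF \<phi>_inj] t s by metis
      moreover have "lincomb F n M x = t x" if "x \<in> V" for x using that by (simp add: t_def)
      ultimately show "\<exists>h<m. \<forall>x \<in> V. lincomb F n M x = lincomb F n (B h) x"
        using h lin by (intro exI[of _ h]) simp
    qed
    moreover have "\<forall>h i. B h i \<in> V" using s Aut_closed by (simp add: B_def)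
    ultimately show "\<exists>B. (\<forall>h i. B h i \<in> V) \<and> aut_matrices F n c u m T B" by blast
  }
qed

end

section \<open>Formulas about vectors\<close>

text \<open>A vector variable is a block of \<open>n\<close> consecutive ring variables. Blocks are addressed by
  triples \<open>(t, i, j)\<close>, where the tag \<open>t\<close> is \<open>0\<close> for the structure constants, \<open>1\<close> for the unit, \<open>2\<close> for
  the matrices of the automorphisms, and \<open>3\<close> and \<open>4\<close> for bound vectors and bound matrices.\<close>

definition blk :: "nat \<Rightarrow> nat \<Rightarrow> nat \<Rightarrow> nat" where
  "blk t i j = prod_encode (t, prod_encode (i, j))"

lemma blk_eq_iff [simp]: "blk t i j = blk t' i' j' \<longleftrightarrow> t = t' \<and> i = i' \<and> j = j'"
  by (simp add: blk_def prod_encode_eq)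

text \<open>For n > 0 each variable is \<open>b * n + i\<close> for a unique block \<open>b\<close>
  and \<open>i < n\<close>, so families of vectors and assignments of scalars determine each
  other.\<close>

definition block_env :: "nat \<Rightarrow> (nat \<Rightarrow> nat \<Rightarrow> 'a) \<Rightarrow> nat \<Rightarrow> 'a" where
  "block_env n E v = E (v div n) (v mod n)"

definition block_vars :: "nat \<Rightarrow> nat list \<Rightarrow> nat list" where
  "block_vars n bs = concat (map (\<lambda>b. [b * n..<b * n + n]) bs)"

primrec sum_term :: "(nat \<Rightarrow> rterm) \<Rightarrow> nat \<Rightarrow> rterm" where
  "sum_term f 0 = RZero"
| "sum_term f (Suc k) = RAdd (f k) (sum_term f k)"

primrec all_form :: "(nat \<Rightarrow> rform) \<Rightarrow> nat \<Rightarrow> rform" where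
  "all_form f 0 = REq RZero RZero"
| "all_form f (Suc k) = RConj (f k) (all_form f k)"

definition ex_form :: "(nat \<Rightarrow> rform) \<Rightarrow> nat \<Rightarrow> rform" where
  "ex_form f k = RNeg (all_form (\<lambda>i. RNeg (f i)) k)"

definition imp_form :: "rform \<Rightarrow> rform \<Rightarrow> rform" where
  "imp_form p q = RNeg (RConj p (RNeg q))"

definition vex_form :: "nat \<Rightarrow> nat list \<Rightarrow> rform \<Rightarrow> rform" where
  "vex_form n bs p = foldr REx (block_vars n bs) p"

definition vall_form :: "nat \<Rightarrow> nat list \<Rightarrow> rform \<Rightarrow> rform" where
  "vall_form n bs p = RNeg (vex_form n bs (RNeg p))"

definition vvar :: "nat \<Rightarrow> nat \<Rightarrow> nat \<Rightarrow> rterm" where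
  "vvar n b i = RVar (b * n + i)"

definition vzero :: "nat \<Rightarrow> rterm" where
  "vzero i = RZero"

definition vadd :: "(nat \<Rightarrow> rterm) \<Rightarrow> (nat \<Rightarrow> rterm) \<Rightarrow> nat \<Rightarrow> rterm" where
  "vadd s t i = RAdd (s i) (t i)"

definition vlin :: "nat \<Rightarrow> (nat \<Rightarrow> nat \<Rightarrow> rterm) \<Rightarrow> (nat \<Rightarrow> rterm) \<Rightarrow> nat \<Rightarrow> rterm" where
  "vlin n B t k = sum_term (\<lambda>i. RMult (t i) (B i k)) n"

text \<open>The structure constants are read directly from the blocks with tag 0.\<close>

definition vmul :: "nat \<Rightarrow> (nat \<Rightarrow> rterm) \<Rightarrow> (nat \<Rightarrow> rterm) \<Rightarrow> nat \<Rightarrow> rterm" where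
  "vmul n s t = vlin n (\<lambda>i. vlin n (\<lambda>j. vvar n (blk 0 i j)) t) s"

definition veq :: "nat \<Rightarrow> (nat \<Rightarrow> rterm) \<Rightarrow> (nat \<Rightarrow> rterm) \<Rightarrow> rform" where
  "veq n s t = all_form (\<lambda>i. REq (s i) (t i)) n"

definition vval :: "('a, 'k) ring_scheme \<Rightarrow> nat \<Rightarrow> (nat \<Rightarrow> nat \<Rightarrow> 'a) \<Rightarrow> (nat \<Rightarrow> rterm) \<Rightarrow> nat \<Rightarrow> 'a" where
  "vval F n E t = (\<lambda>k \<in> {..<n}. rterm_val F (block_env n E) (t k))"

definition vholds :: "('a, 'k) ring_scheme \<Rightarrow> nat \<Rightarrow> (nat \<Rightarrow> nat \<Rightarrow> 'a) \<Rightarrow> rform \<Rightarrow> bool" where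
  "vholds F n E p \<longleftrightarrow> holds F (block_env n E) p"

lemma set_block_vars: "n > 0 \<Longrightarrow> v \<in> set (block_vars n bs) \<longleftrightarrow> v div n \<in> set bs"
proof -
  assume n: "n > 0"
  have "b * n \<le> v \<and> v < b * n + n \<longleftrightarrow> v div n = b" for b
    using n by (metis add.commute div_nat_eqI div_times_less_eq_dividend dividend_less_div_times
        mult.commute mult_Suc_right)
  then show ?thesis by (auto simp: block_vars_def)
qed

lemma vholds_simps [simp]:
  "vholds F n E (RNeg p) \<longleftrightarrow> \<not> vholds F n E p"
  "vholds F n E (RConj p q) \<longleftrightarrow> vholds F n E p \<and> vholds F n E q"
  "vholds F n E (imp_form p q) \<longleftrightarrow> (vholds F n E p \<longrightarrow> vholds F n E q)"
  by (auto simp: vholds_def imp_form_def)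

lemma vholds_all_form [simp]: "vholds F n E (all_form f k) \<longleftrightarrow> (\<forall>i<k. vholds F n E (f i))"
  by (induction k) (auto simp: vholds_def less_Suc_eq)

lemma vholds_ex_form [simp]: "vholds F n E (ex_form f k) \<longleftrightarrow> (\<exists>i<k. vholds F n E (f i))"
  by (simp add: ex_form_def)

text \<open>A quantifier over the variables of some blocks is a quantifier over the vectors stored
  there.\<close>

lemma vholds_vex_form:
  assumes n: "n > 0" and E: "\<And>b. E b \<in> vecs F n"
  shows "vholds F n E (vex_form n bs p) \<longleftrightarrow>
    (\<exists>E'. (\<forall>b. E' b \<in> vecs F n) \<and> (\<forall>b. b \<notin> set bs \<longrightarrow> E' b = E b) \<and> vholds F n E' p)"
proof
  assume "vholds F n E (vex_form n bs p)"
  then obtain e where e: "\<forall>v. v div n \<notin> set bs \<longrightarrow> e v = block_env n E v"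
      "\<forall>v. v div n \<in> set bs \<longrightarrow> e v \<in> carrier F" "holds F e p"
    unfolding vholds_def vex_form_def holds_foldr_REx set_block_vars[OF n]
    using set_block_vars[OF n] by (metis image_subset_iff)
  define E' where "E' b = (\<lambda>i \<in> {..<n}. e (b * n + i))" for b
  have "block_env n E' = e"
    using n by (auto simp: block_env_def E'_def)
  \<comment> \<open>Equality as functions: beyond n, extensionality of \<open>E b\<close> supplies
    the common value \<open>undefined\<close>.\<close>
  moreover have "E' b = E b" if "b \<notin> set bs" for b
    using PiE_arb[OF E[of b, unfolded vecs_def]] that n e(1)
    by (auto simp: E'_def block_env_def fun_eq_iff)
  moreover have "E' b \<in> vecs F n" for b
    using calculation(2)[of b] E[of b] e(2) n
    by (cases "b \<in> set bs") (auto simp: E'_def intro!: vecsI)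
  ultimately show "\<exists>E'. (\<forall>b. E' b \<in> vecs F n) \<and> (\<forall>b. b \<notin> set bs \<longrightarrow> E' b = E b) \<and> vholds F n E' p"
    using e(3) unfolding vholds_def by blast
next
  assume "\<exists>E'. (\<forall>b. E' b \<in> vecs F n) \<and> (\<forall>b. b \<notin> set bs \<longrightarrow> E' b = E b) \<and> vholds F n E' p"
  then obtain E' where E': "\<And>b. E' b \<in> vecs F n" "\<And>b. b \<notin> set bs \<Longrightarrow> E' b = E b" "holds F (block_env n E') p"
    unfolding vholds_def by blast
  have "block_env n E' v \<in> carrier F" for v
    unfolding block_env_def using n by (intro vecs_nth[OF E'(1)]) simp
  then show "vholds F n E (vex_form n bs p)"
    unfolding vholds_def vex_form_def holds_foldr_REx
    using E' set_block_vars[OF n, of _ bs]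
    by (intro exI[of _ "block_env n E'"]) (auto simp: block_env_def)
qed

lemma vholds_vex_form_single:
  assumes "n > 0" and "\<And>b. E b \<in> vecs F n"
  shows "vholds F n E (vex_form n [b] p) \<longleftrightarrow> (\<exists>x \<in> vecs F n. vholds F n (E(b := x)) p)"
  unfolding vholds_vex_form[OF assms]
proof
  assume "\<exists>E'. (\<forall>b. E' b \<in> vecs F n) \<and> (\<forall>b'. b' \<notin> set [b] \<longrightarrow> E' b' = E b') \<and> vholds F n E' p"
  then obtain E' where E': "\<forall>b. E' b \<in> vecs F n" "\<forall>b'. b' \<notin> set [b] \<longrightarrow> E' b' = E b'" "vholds F n E' p"
    by blast
  then have "E' = E(b := E' b)" by auto
  then show "\<exists>x \<in> vecs F n. vholds F n (E(b := x)) p" using E' by metis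
next
  assume "\<exists>x \<in> vecs F n. vholds F n (E(b := x)) p"
  then obtain x where "x \<in> vecs F n" "vholds F n (E(b := x)) p" by blast
  then show "\<exists>E'. (\<forall>b. E' b \<in> vecs F n) \<and> (\<forall>b'. b' \<notin> set [b] \<longrightarrow> E' b' = E b') \<and> vholds F n E' p"
    using assms(2) by (intro exI[of _ "E(b := x)"]) auto
qed

lemma vholds_vall_form:
  assumes "n > 0" and "\<And>b. E b \<in> vecs F n"
  shows "vholds F n E (vall_form n bs p) \<longleftrightarrow>
    (\<forall>E'. (\<forall>b. E' b \<in> vecs F n) \<and> (\<forall>b. b \<notin> set bs \<longrightarrow> E' b = E b) \<longrightarrow> vholds F n E' p)"
  unfolding vall_form_def by (auto simp: vholds_vex_form[OF assms])

lemma vholds_vall_form_single: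
  assumes "n > 0" and "\<And>b. E b \<in> vecs F n"
  shows "vholds F n E (vall_form n [b] p) \<longleftrightarrow> (\<forall>x \<in> vecs F n. vholds F n (E(b := x)) p)"
  unfolding vall_form_def by (auto simp: vholds_vex_form_single[OF assms])

section \<open>Evaluation of vector terms\<close>

context field
begin

lemma vval_closed [simp]:
  assumes "n > 0" and "\<And>b. E b \<in> vecs R n"
  shows "vval R n E t \<in> vecs R n"
  unfolding vval_def
proof (intro vecsI rterm_val_closed[OF ring_axioms])
  show "range (block_env n E) \<subseteq> carrier R"
    using assms vecs_nth by (fastforce simp: block_env_def)
qed

lemma vval_vvar:
  assumes "E b \<in> vecs R n"
  shows "vval R n E (vvar n b) = E b"
  by (rule vecs_eqI[OF _ assms])
     (use assms vecs_nth[OF assms] in \<open>auto simp: vval_def vvar_def block_env_def intro!: vecsI\<close>)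

lemma vval_vzero: "vval R n E vzero = (\<lambda>k \<in> {..<n}. \<zero>)"
  by (simp add: vval_def vzero_def)

lemma vval_vadd: "vval R n E (vadd s t) = vec_add R n (vval R n E s) (vval R n E t)"
  by (auto simp: vval_def vadd_def vec_add_def)

lemma rterm_val_sum_term:
  assumes "range e \<subseteq> carrier R"
  shows "rterm_val R e (sum_term f k) = (\<Oplus>i\<in>{..<k}. rterm_val R e (f i))"
  by (induction k) (simp_all add: lessThan_Suc rterm_val_closed[OF ring_axioms assms])

lemma vval_vlin:
  assumes "n > 0" and "\<And>b. E b \<in> vecs R n"
  shows "vval R n E (vlin n B t) = lincomb R n (\<lambda>i. vval R n E (B i)) (vval R n E t)"
proof -
  have e: "range (block_env n E) \<subseteq> carrier R"
    using assms vecs_nth by (fastforce simp: block_env_def)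
  show ?thesis
    unfolding vval_def[of R n E "vlin n B t"] lincomb_def vlin_def rterm_val_sum_term[OF e]
    by (intro restrict_ext finsum_cong')
       (auto simp: vval_def rterm_val_closed[OF ring_axioms e])
qed

lemma vval_vmul:
  assumes "n > 0" and "\<And>b. E b \<in> vecs R n"
  shows "vval R n E (vmul n s t) =
    vec_mult R n (\<lambda>i j. E (blk 0 i j)) (vval R n E s) (vval R n E t)"
  unfolding vmul_def vec_mult_def by (simp add: vval_vlin[OF assms] vval_vvar[OF assms(2)])

lemma vholds_veq: "vholds R n E (veq n s t) \<longleftrightarrow> vval R n E s = vval R n E t"
  unfolding veq_def vholds_all_form by (auto simp: vholds_def vval_def fun_eq_iff restrict_def)

end

section \<open>The formula of an extension\<close>

definition x_blk :: "nat \<Rightarrow> nat" where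
  "x_blk i = blk 3 i 0"

text \<open>The conjuncts are the conditions of \<open>field_coord_algebra_iff\<close>.\<close>

definition field_form :: "nat \<Rightarrow> rform" where
  "field_form n = (let x = vvar n (x_blk 0); y = vvar n (x_blk 1); z = vvar n (x_blk 2); u = vvar n (blk 1 0 0) in
     RConj (vall_form n [x_blk 0] (vall_form n [x_blk 1] (veq n (vmul n x y) (vmul n y x))))
    (RConj (vall_form n [x_blk 0] (vall_form n [x_blk 1] (vall_form n [x_blk 2]
       (veq n (vmul n (vmul n x y) z) (vmul n x (vmul n y z))))))
    (RConj (vall_form n [x_blk 0] (vall_form n [x_blk 1] (vall_form n [x_blk 2]
       (veq n (vmul n (vadd x y) z) (vadd (vmul n x z) (vmul n y z))))))
    (RConj (vall_form n [x_blk 0] (veq n (vmul n u x) x))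
    (RConj (RNeg (veq n u vzero))
    (vall_form n [x_blk 0] (imp_form (RNeg (veq n x vzero))
       (vex_form n [x_blk 1] (veq n (vmul n x y) u)))))))))"

text \<open>\<open>M\<close> gives the blocks that hold the rows, so the same formula serves for the
  listed matrices and for the universally quantified one.\<close>

definition aut_form :: "nat \<Rightarrow> (nat \<Rightarrow> nat) \<Rightarrow> rform" where
  "aut_form n M = (let x = vvar n (x_blk 0); y = vvar n (x_blk 1); u = vvar n (blk 1 0 0);
       s = vlin n (\<lambda>i. vvar n (M i)) in
     RConj (veq n (s u) u)
    (RConj (vall_form n [x_blk 0] (vall_form n [x_blk 1] (veq n (s (vmul n x y)) (vmul n (s x) (s y)))))
    (vall_form n [x_blk 1] (vex_form n [x_blk 0] (veq n (s x) y)))))"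

text \<open>The free variables are the structure constants, the unit and the matrices of the automorphisms;
  the existential closure turns them into data to be found in \<open>F\<close>. \<open>T\<close> is the multiplication table
  of \<open>H\<close>, for an enumeration of its elements by \<open>0, \<dots>, m - 1\<close>.\<close>

definition ext_form :: "nat \<Rightarrow> nat \<Rightarrow> (nat \<Rightarrow> nat \<Rightarrow> nat) \<Rightarrow> rform" where
  "ext_form n m T = (let x = vvar n (x_blk 0); s = (\<lambda>h. vlin n (\<lambda>i. vvar n (blk 2 h i)));
       t = vlin n (\<lambda>i. vvar n (blk 4 i 0)) in
     RConj (field_form n)
    (RConj (all_form (\<lambda>h. aut_form n (blk 2 h)) m)
    (RConj (all_form (\<lambda>h. all_form (\<lambda>k. if h = k then REq RZero RZero else
       vex_form n [x_blk 0] (RNeg (veq n (s h x) (s k x)))) m) m)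
    (RConj (all_form (\<lambda>h. all_form (\<lambda>k.
       vall_form n [x_blk 0] (veq n (s h (s k x)) (s (T h k) x))) m) m)
    (vall_form n (map (\<lambda>i. blk 4 i 0) [0..<n]) (imp_form (aut_form n (\<lambda>i. blk 4 i 0))
       (ex_form (\<lambda>h. vall_form n [x_blk 0] (veq n (t x) (s h x))) m)))))))"

text \<open>The quantified blocks hold n rows, whereas \<open>M\<close> has rows for all indices;
  this lemma mediates.\<close>

lemma aut_matrix_cong:
  assumes F: "field F" and c: "\<And>i j. c i j \<in> vecs F n" and u: "u \<in> vecs F n"
    and M: "\<And>i. i < n \<Longrightarrow> M i \<in> vecs F n" and eq: "\<And>i. i < n \<Longrightarrow> M i = M' i"
  shows "aut_matrix F n c u M \<longleftrightarrow> aut_matrix F n c u M'"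
proof -
  interpret field F by fact
  have "lincomb F n M x = lincomb F n M' x" if "x \<in> vecs F n" for x
    by (rule lincomb_cong[OF eq M that])
  then show ?thesis using c u unfolding aut_matrix_def by (auto simp: vec_mult_closed)
qed

context field
begin

text \<open>Addition is coordinatewise, so the additive group comes for free; commutativity of the
  product supplies the other half of each one-sided axiom.\<close>

lemma field_coord_algebra_iff:
  assumes c: "\<And>i j. c i j \<in> vecs R n" and u: "u \<in> vecs R n"
  shows "field (coord_algebra R n c u) \<longleftrightarrow>
    (\<forall>x \<in> vecs R n. \<forall>y \<in> vecs R n. vec_mult R n c x y = vec_mult R n c y x) \<and>
    (\<forall>x \<in> vecs R n. \<forall>y \<in> vecs R n. \<forall>z \<in> vecs R n.
       vec_mult R n c (vec_mult R n c x y) z = vec_mult R n c x (vec_mult R n c y z)) \<and>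
    (\<forall>x \<in> vecs R n. \<forall>y \<in> vecs R n. \<forall>z \<in> vecs R n.
       vec_mult R n c (vec_add R n x y) z = vec_add R n (vec_mult R n c x z) (vec_mult R n c y z)) \<and>
    (\<forall>x \<in> vecs R n. vec_mult R n c u x = x) \<and>
    u \<noteq> (\<lambda>k \<in> {..<n}. \<zero>) \<and>
    (\<forall>x \<in> vecs R n. x \<noteq> (\<lambda>k \<in> {..<n}. \<zero>) \<longrightarrow> (\<exists>y \<in> vecs R n. vec_mult R n c x y = u))"
    (is "field ?A \<longleftrightarrow> ?R")
proof
  assume "field ?A"
  then interpret A: field ?A .
  have "\<exists>y \<in> vecs R n. vec_mult R n c x y = u" if "x \<in> vecs R n" "x \<noteq> (\<lambda>k \<in> {..<n}. \<zero>)" for x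
  proof -
    have "x \<in> Units ?A" using that by (simp add: A.field_Units)
    then show ?thesis using A.Units_r_inv_ex[of x] by auto
  qed
  then show ?R
    using A.m_comm A.m_assoc A.l_distr A.l_one A.one_not_zero by simp
next
  assume r: ?R
  have "abelian_group ?A"
  proof (rule abelian_groupI)
    show "\<exists>y \<in> carrier ?A. y \<oplus>\<^bsub>?A\<^esub> x = \<zero>\<^bsub>?A\<^esub>" if "x \<in> carrier ?A" for x
      using that vecs_nth[of x R n]
      by (intro bexI[of _ "\<lambda>k \<in> {..<n}. \<ominus> x k"]) (auto simp: vec_add_def l_neg intro!: restrict_ext vecsI)
  qed (auto intro!: vecs_eqI[of _ R n] simp: vecs_nth[where n = n and F = R] a_ac)
  moreover have "comm_monoid ?A"
    using r c u by (intro comm_monoidI) auto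
  ultimately have "cring ?A"
    using r by (intro cringI) auto
  then show "field ?A"
    by (rule cring.cring_fieldI2) (use r in auto)
qed

lemma vholds_field_form:
  assumes n: "n > 0" and E: "\<And>b. E b \<in> vecs R n"
  shows "vholds R n E (field_form n) \<longleftrightarrow> field (coord_algebra R n (\<lambda>i j. E (blk 0 i j)) (E (blk 1 0 0)))"
  unfolding field_form_def Let_def
  by (simp add: n E vholds_vall_form_single vholds_vex_form_single vholds_veq vval_vmul vval_vvar
      vval_vadd vval_vzero x_blk_def field_coord_algebra_iff)

text \<open>The last hypothesis prevents the bound vectors of the formula from overwriting the rows
  of the matrix.\<close>

lemma vholds_aut_form:
  assumes n: "n > 0" and E: "\<And>b. E b \<in> vecs R n" and M: "\<And>i k. M i \<noteq> x_blk k"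
  shows "vholds R n E (aut_form n M) \<longleftrightarrow>
    aut_matrix R n (\<lambda>i j. E (blk 0 i j)) (E (blk 1 0 0)) (\<lambda>i. E (M i))"
  using M unfolding aut_form_def Let_def aut_matrix_def
  by (simp add: n E vholds_vall_form_single vholds_vex_form_single vholds_veq vval_vmul vval_vvar
      vval_vlin x_blk_def)

lemma vholds_ext_form:
  assumes n: "n > 0" and E: "\<And>b. E b \<in> vecs R n"
  shows "vholds R n E (ext_form n m T) \<longleftrightarrow>
    field (coord_algebra R n (\<lambda>i j. E (blk 0 i j)) (E (blk 1 0 0))) \<and>
    aut_matrices R n (\<lambda>i j. E (blk 0 i j)) (E (blk 1 0 0)) m T (\<lambda>h i. E (blk 2 h i))"
proof -
  let ?c = "\<lambda>i j. E (blk 0 i j)" and ?u = "E (blk 1 0 0)" and ?B = "\<lambda>h i. E (blk 2 h i)"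
  let ?bs = "map (\<lambda>i. blk 4 i 0) [0..<n]"
  define p where "p = imp_form (aut_form n (\<lambda>i. blk 4 i 0))
     (ex_form (\<lambda>h. vall_form n [x_blk 0] (veq n (vlin n (\<lambda>i. vvar n (blk 4 i 0)) (vvar n (x_blk 0)))
        (vlin n (\<lambda>i. vvar n (blk 2 h i)) (vvar n (x_blk 0))))) m)"
  have "vholds R n E (vall_form n ?bs p) \<longleftrightarrow>
    (\<forall>M. (\<forall>i. M i \<in> vecs R n) \<and> aut_matrix R n ?c ?u M \<longrightarrow>
        (\<exists>h<m. \<forall>x \<in> vecs R n. lincomb R n M x = lincomb R n (?B h) x))" (is "?L \<longleftrightarrow> ?R")
  proof -
    have sem: "vholds R n E' p \<longleftrightarrow>
      (aut_matrix R n ?c ?u (\<lambda>i. E' (blk 4 i 0)) \<longrightarrow>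
        (\<exists>h<m. \<forall>x \<in> vecs R n. lincomb R n (\<lambda>i. E' (blk 4 i 0)) x = lincomb R n (?B h) x))"
      if E': "\<forall>b. E' b \<in> vecs R n" "\<forall>b. b \<notin> set ?bs \<longrightarrow> E' b = E b" for E'
    proof -
      \<comment> \<open>The quantified blocks all have tag 4, so constants, unit and listed matrices
        keep their values.\<close>
      have "E' (blk 0 i j) = E (blk 0 i j)" "E' (blk 1 i j) = E (blk 1 i j)" "E' (blk 2 i j) = E (blk 2 i j)" for i j
        using E'(2) by (simp_all add: image_iff)
      then show ?thesis
        using E E'(1) n
        by (simp add: p_def vholds_aut_form vholds_vall_form_single vholds_veq vval_vvar vval_vlin x_blk_def)
    qed
    show ?thesis
      unfolding vholds_vall_form[OF n E]
    proof
      assume l: "\<forall>E'. (\<forall>b. E' b \<in> vecs R n) \<and> (\<forall>b. b \<notin> set ?bs \<longrightarrow> E' b = E b) \<longrightarrow>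
        vholds R n E' p"
      show ?R
      proof (intro allI impI)
        fix M assume M: "(\<forall>i. M i \<in> vecs R n) \<and> aut_matrix R n ?c ?u M"
        \<comment> \<open>Decoding the address \<open>blk 4 i 0\<close> recovers the row number
          i.\<close>
        define E' where "E' b = (if b \<in> set ?bs then M (fst (prod_decode (snd (prod_decode b)))) else E b)" for b
        have E'_M: "M i = E' (blk 4 i 0)" if "i < n" for i
          using that by (auto simp: E'_def blk_def)
        have E': "\<forall>b. E' b \<in> vecs R n" "\<forall>b. b \<notin> set ?bs \<longrightarrow> E' b = E b"
          using M E by (auto simp: E'_def)
        have "aut_matrix R n ?c ?u M \<longleftrightarrow> aut_matrix R n ?c ?u (\<lambda>i. E' (blk 4 i 0))"
          by (rule aut_matrix_cong[OF field_axioms]) (use E M E'_M E'(1) in auto)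
        then have "aut_matrix R n ?c ?u (\<lambda>i. E' (blk 4 i 0))" using M by blast
        then obtain h where h: "h < m" "\<forall>x \<in> vecs R n. lincomb R n (\<lambda>i. E' (blk 4 i 0)) x = lincomb R n (?B h) x"
          using l E' sem[OF E'] by blast
        moreover have "lincomb R n M x = lincomb R n (\<lambda>i. E' (blk 4 i 0)) x" if "x \<in> vecs R n" for x
          by (rule lincomb_cong) (use M that E'_M E'(1) in auto)
        ultimately show "\<exists>h<m. \<forall>x \<in> vecs R n. lincomb R n M x = lincomb R n (?B h) x" by auto
      qed
    next
      assume r: ?R
      show "\<forall>E'. (\<forall>b. E' b \<in> vecs R n) \<and> (\<forall>b. b \<notin> set ?bs \<longrightarrow> E' b = E b) \<longrightarrow> vholds R n E' p"
      proof (intro allI impI)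
        fix E' assume E': "(\<forall>b. E' b \<in> vecs R n) \<and> (\<forall>b. b \<notin> set ?bs \<longrightarrow> E' b = E b)"
        then show "vholds R n E' p"
          unfolding sem[OF conjunct1[OF E'] conjunct2[OF E']]
          using r[rule_format, of "\<lambda>i. E' (blk 4 i 0)"] by blast
      qed
    qed
  qed
  \<comment> \<open>The indices are compared while the formula is built; on the diagonal a true
    equation takes the place of the condition.\<close>
  moreover have "vholds R n E (if h = k then REq RZero RZero else q) \<longleftrightarrow> (h \<noteq> k \<longrightarrow> vholds R n E q)"
    for h k :: nat and q
    by (simp add: vholds_def)
  ultimately show ?thesis
    unfolding ext_form_def Let_def aut_matrices_def p_def[symmetric]
    by (simp add: n E vholds_vall_form_single vholds_vex_form_single vholds_veq vval_vvar
      vval_vlin x_blk_def vholds_field_form vholds_aut_form)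
qed

end

theorem ex_ext_form_iff:
  fixes F :: "'a ring"
  assumes F: "field F" and n: "n > 0" and H: "group H" and g: "bij_betw g {..<m} (carrier H)"
    and T: "\<And>h k. h < m \<Longrightarrow> k < m \<Longrightarrow> T h k < m \<and> g (T h k) = g h \<otimes>\<^bsub>H\<^esub> g k"
  shows "F \<Turnstile>\<^sub>R REx_upto n (ex_closure (ext_form n m T)) \<longleftrightarrow> has_ext_with_Aut F n H"
proof -
  interpret F: field F by (rule F)
  have "F \<Turnstile>\<^sub>R REx_upto n (ex_closure (ext_form n m T)) \<longleftrightarrow>
      (\<exists>e. range e \<subseteq> carrier F \<and> holds F e (ext_form n m T))"
    by (rule models_ex_closure) (use F.one_closed in blast)
  also have "\<dots> \<longleftrightarrow> (\<exists>E. (\<forall>b. E b \<in> vecs F n) \<and> vholds F n E (ext_form n m T))"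
  proof
    assume "\<exists>e. range e \<subseteq> carrier F \<and> holds F e (ext_form n m T)"
    then obtain e where e: "range e \<subseteq> carrier F" "holds F e (ext_form n m T)" by blast
    \<comment> \<open>Any assignment is cut into blocks of length n.\<close>
    define E where "E b = (\<lambda>i \<in> {..<n}. e (b * n + i))" for b
    have "block_env n E = e" using n by (auto simp: block_env_def E_def)
    moreover have "E b \<in> vecs F n" for b unfolding E_def using e(1) by (intro vecsI) auto
    ultimately show "\<exists>E. (\<forall>b. E b \<in> vecs F n) \<and> vholds F n E (ext_form n m T)"
      using e(2) unfolding vholds_def by metis
  next
    assume "\<exists>E. (\<forall>b. E b \<in> vecs F n) \<and> vholds F n E (ext_form n m T)"
    then obtain E where E: "\<And>b. E b \<in> vecs F n" "holds F (block_env n E) (ext_form n m T)"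
      unfolding vholds_def by blast
    have "block_env n E v \<in> carrier F" for v
      unfolding block_env_def using n by (intro vecs_nth[OF E(1)]) simp
    then show "\<exists>e. range e \<subseteq> carrier F \<and> holds F e (ext_form n m T)" using E(2) by blast
  qed
  also have "\<dots> \<longleftrightarrow> has_ext_with_Aut F n H"
  proof
    assume "\<exists>E. (\<forall>b. E b \<in> vecs F n) \<and> vholds F n E (ext_form n m T)"
    then obtain E where E: "\<And>b. E b \<in> vecs F n" "vholds F n E (ext_form n m T)" by blast
    let ?c = "\<lambda>i j. E (blk 0 i j)" and ?u = "E (blk 1 0 0)"
    note sem = E(2)[unfolded F.vholds_ext_form[OF n E(1)]]
    interpret cf: coord_field F n ?c ?u
      by (intro coord_field.intro[OF F] coord_field_axioms.intro E(1) conjunct1[OF sem])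
    have "Aut_ext F (coord_algebra F n ?c ?u) (smult_vec F n ?u) \<cong> H"
      by (subst cf.Aut_iso_iff_aut_matrices[OF H g, of T])
         (use T sem E(1) in \<open>auto intro!: exI[of _ "\<lambda>h i. E (blk 2 h i)"]\<close>)
    \<comment> \<open>\<open>has_ext_with_AutI\<close> replaces the coordinate algebra by a copy on
      \<open>'a list\<close>.\<close>
    then show "has_ext_with_Aut F n H"
      using has_ext_with_AutI cf.is_ext_with_Aut_coord_algebra_iff by blast
  next
    assume "has_ext_with_Aut F n H"
    then obtain L :: "'a list ring" and h where "is_ext_with_Aut F L h n H"
      unfolding has_ext_with_Aut_def by blast
    then obtain c u where cu: "\<And>i j. c i j \<in> vecs F n" "u \<in> vecs F n"
      "field (coord_algebra F n c u)" "Aut_ext F (coord_algebra F n c u) (smult_vec F n u) \<cong> H"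
      by (rule ext_iso_coord_algebra) blast
    interpret cf: coord_field F n c u
      by (intro coord_field.intro[OF F] coord_field_axioms.intro cu)
    obtain B where B: "\<forall>h i. B h i \<in> vecs F n" "aut_matrices F n c u m T B"
      using cu(4) cf.Aut_iso_iff_aut_matrices[OF H g, of T] T by blast
    \<comment> \<open>The data are stored by tag; blocks with tags 3 and 4 are bound in the formula
      and receive arbitrary vectors.\<close>
    define E where "E b = (case prod_decode b of (t, p) \<Rightarrow> case prod_decode p of (i, j) \<Rightarrow>
        if t = 0 then c i j else if t = 1 then u else B i j)" for b
    have "E b \<in> vecs F n" for b using cu(1,2) B(1) by (auto simp: E_def split: prod.split)
    moreover have "E (blk 0 i j) = c i j" "E (blk (Suc 0) i j) = u" "E (blk 2 i j) = B i j" for i j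
      by (simp_all add: E_def blk_def)
    ultimately show "\<exists>E. (\<forall>b. E b \<in> vecs F n) \<and> vholds F n E (ext_form n m T)"
      using cu(3) B(2) by (intro exI[of _ E]) (simp add: F.vholds_ext_form[OF n])
  qed
  finally show ?thesis .
qed

theorem theorem3p3:
  fixes H :: "'h monoid" and m n :: nat
  assumes "group H" and "finite (carrier H)" and "order H = m"
    and "n > 0" and "m dvd n"
  shows "free_vars (\<epsilon> H n) \<subseteq> {1..n} \<and>
    (\<forall>F :: 'a ring. field F \<longrightarrow>
       (F \<Turnstile>\<^sub>R REx_upto n (\<epsilon> H n) \<longleftrightarrow> has_ext_with_Aut F n H))"
proof -
  interpret H: group H by fact
  obtain g where g: "bij_betw g {..<m} (carrier H)"
    using ex_bij_betw_nat_finite[OF assms(2)] assms(3) by (auto simp: order_def atLeast0LessThan)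
  define T where "T h k = inv_into {..<m} g (g h \<otimes>\<^bsub>H\<^esub> g k)" for h k
  have T: "T h k < m \<and> g (T h k) = g h \<otimes>\<^bsub>H\<^esub> g k" if "h < m" "k < m" for h k
  proof -
    have "g h \<otimes>\<^bsub>H\<^esub> g k \<in> g ` {..<m}" using g that by (auto simp: bij_betw_def)
    then show ?thesis
      unfolding T_def using inv_into_into[of _ g "{..<m}"] f_inv_into_f[of _ g "{..<m}"] by auto
  qed
  let ?p = "ex_closure (ext_form n m T)"
  \<comment> \<open>The same sentence \<open>?p\<close> at two field types: on \<open>nat\<close> it
    shows that the choice defining \<epsilon> has a candidate, and on \<open>'a\<close> it is the
    sentence to compare with.\<close>
  have p_nat: "F \<Turnstile>\<^sub>R REx_upto n ?p \<longleftrightarrow> has_ext_with_Aut F n H" if "field F" for F :: "nat ring"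
    by (rule ex_ext_form_iff[OF that assms(4,1) g]) (rule T)
  have p: "F \<Turnstile>\<^sub>R REx_upto n ?p \<longleftrightarrow> has_ext_with_Aut F n H" if "field F" for F :: "'a ring"
    by (rule ex_ext_form_iff[OF that assms(4,1) g]) (rule T)
  have \<epsilon>: "free_vars (\<epsilon> H n) \<subseteq> {1..n} \<and>
     (\<forall>F :: nat ring. field F \<longrightarrow> (F \<Turnstile>\<^sub>R REx_upto n (\<epsilon> H n) \<longleftrightarrow> has_ext_with_Aut F n H))"
    unfolding ext_formula_def
    by (rule someI[of _ ?p]) (simp add: p_nat)
  have "F \<Turnstile>\<^sub>R REx_upto n (\<epsilon> H n) \<longleftrightarrow> has_ext_with_Aut F n H" if F: "field F" for F :: "'a ring"
  proof -
    obtain F' :: "nat ring" where F': "field F'"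
      "\<And>q. free_vars q \<subseteq> {1..n} \<Longrightarrow> F' \<Turnstile>\<^sub>R REx_upto n q \<longleftrightarrow> F \<Turnstile>\<^sub>R REx_upto n q"
      using countable_elementary_field[OF F] by blast
    have "F \<Turnstile>\<^sub>R REx_upto n (\<epsilon> H n) \<longleftrightarrow> F' \<Turnstile>\<^sub>R REx_upto n ?p"
      using \<epsilon> F' p_nat by blast
    also have "\<dots> \<longleftrightarrow> F \<Turnstile>\<^sub>R REx_upto n ?p" by (rule F'(2)) simp
    finally show ?thesis using p[OF F] by simp
  qed
  then show ?thesis using \<epsilon> by blast
qed

end
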